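(* Let $x$ be a positive integer. A $k$-uniform hypergraph $G(V,E)$ with $|E|\le 2^{(k-1)x-1}$ has a bicoloring cover of size $x$, and such a cover can be computed by a randomized algorithm in expected polynomial time.
   Context: A bicoloring of $G$ is a map $X:V\to\{0,1\}$; a bicoloring cover of $G$ is a set of bicolorings such that every hyperedge is non-monochromatic under at least one of them.
   Formalization: A cover of size x has exactly x bicolorings when x ≤ 2^|V|; when x > 2^|V| no set of x distinct bicolorings exists (e.g. |V|=k=2, one edge, x=5), and the cover is then only required to have at most x members. *)

theory Defs
  imports "HOL-Probability.Probability" "HOL-Computational_Algebra.Polynomial"
begin

definition uniform_hypergraph :: "nat \<Rightarrow> 'a set \<Rightarrow> 'a set set \<Rightarrow> bool" where
  "uniform_hypergraph k V E \<longleftrightarrow> finite V \<and> E \<subseteq> Pow V \<and> (\<forall>e\<in>E. card e = k)"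

text \<open>Bicolorings are extensional functions, so that two of them are equal iff they agree on
  the vertex set and cardinalities of sets of bicolorings are meaningful.\<close>

definition bicolorings :: "'a set \<Rightarrow> ('a \<Rightarrow> nat) set" where
  "bicolorings V = V \<rightarrow>\<^sub>E {0, 1}"

definition monochromatic :: "('a \<Rightarrow> nat) \<Rightarrow> 'a set \<Rightarrow> bool" where
  "monochromatic X e \<longleftrightarrow> (\<forall>u\<in>e. \<forall>v\<in>e. X u = X v)"

definition bicoloring_cover :: "'a set \<Rightarrow> 'a set set \<Rightarrow> ('a \<Rightarrow> nat) set \<Rightarrow> bool" where
  "bicoloring_cover V E C \<longleftrightarrow>
     C \<subseteq> bicolorings V \<and> (\<forall>e\<in>E. \<exists>X\<in>C. \<not> monochromatic X e)"

text \<open>A cover of size \<open>x\<close> has exactly \<open>x\<close> elements, except that if there are fewer than \<open>x\<close>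
  bicolorings altogether (\<open>2 ^ card V < x\<close>) then no set of \<open>x\<close> bicolorings exists and the
  \<open>x\<close> chosen bicolorings necessarily repeat.\<close>

definition bicoloring_cover_of_size ::
    "'a set \<Rightarrow> 'a set set \<Rightarrow> nat \<Rightarrow> ('a \<Rightarrow> nat) set \<Rightarrow> bool" where
  "bicoloring_cover_of_size V E x C \<longleftrightarrow>
     bicoloring_cover V E C \<and> card C \<le> x \<and> (x \<le> 2 ^ card V \<longrightarrow> card C = x)"

text \<open>Programs are while-programs over finitely many arrays of natural numbers (a scalar is an
  array used at index 0 only), extended by fair coin tosses. This is the random access machine
  in structured form. Multiplication is deliberately not a primitive: with addition and
  truncated subtraction only, the bit length of every number grows at most linearly in the
  number of steps, so that unit-cost time is polynomially related to Turing machine time. Since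
  a program is fixed independently of its input, an expression counts as constant work.\<close>

type_synonym store = "string \<Rightarrow> nat \<Rightarrow> nat"

datatype aexp = N nat | Arr string aexp | Plus aexp aexp | Minus aexp aexp

datatype bexp = Less aexp aexp | Not bexp | And bexp bexp

datatype com =
    Skip
  | Assign string aexp aexp
  | Flip string aexp
  | Seq com com
  | If bexp com com
  | While bexp com

fun aval :: "aexp \<Rightarrow> store \<Rightarrow> nat" where
  "aval (N n) s = n"
| "aval (Arr a i) s = s a (aval i s)"
| "aval (Plus e1 e2) s = aval e1 s + aval e2 s"
| "aval (Minus e1 e2) s = aval e1 s - aval e2 s"

fun bval :: "bexp \<Rightarrow> store \<Rightarrow> bool" where
  "bval (Less e1 e2) s \<longleftrightarrow> aval e1 s < aval e2 s"
| "bval (Not b) s \<longleftrightarrow> \<not> bval b s"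
| "bval (And b1 b2) s \<longleftrightarrow> bval b1 s \<and> bval b2 s"

definition update :: "store \<Rightarrow> string \<Rightarrow> nat \<Rightarrow> nat \<Rightarrow> store" where
  "update s a i v = s(a := (s a)(i := v))"

text \<open>\<open>exec c s \<omega> t s' \<omega>'\<close>: started in store \<open>s\<close> with the sequence \<open>\<omega>\<close> of future coin tosses,
  \<open>c\<close> terminates after \<open>t\<close> steps in store \<open>s'\<close>, and \<open>\<omega>'\<close> are the coin tosses not yet used.\<close>

inductive exec ::
    "com \<Rightarrow> store \<Rightarrow> bool stream \<Rightarrow> nat \<Rightarrow> store \<Rightarrow> bool stream \<Rightarrow> bool" where
  Skip: "exec Skip s \<omega> 1 s \<omega>"
| Assign: "exec (Assign a i e) s \<omega> 1 (update s a (aval i s) (aval e s)) \<omega>"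
| Flip: "exec (Flip a i) s \<omega> 1 (update s a (aval i s) (of_bool (shd \<omega>))) (stl \<omega>)"
| Seq: "exec c1 s \<omega> t1 s1 \<omega>1 \<Longrightarrow> exec c2 s1 \<omega>1 t2 s2 \<omega>2 \<Longrightarrow>
    exec (Seq c1 c2) s \<omega> (t1 + t2) s2 \<omega>2"
| IfTrue: "bval b s \<Longrightarrow> exec c1 s \<omega> t s' \<omega>' \<Longrightarrow> exec (If b c1 c2) s \<omega> (1 + t) s' \<omega>'"
| IfFalse: "\<not> bval b s \<Longrightarrow> exec c2 s \<omega> t s' \<omega>' \<Longrightarrow> exec (If b c1 c2) s \<omega> (1 + t) s' \<omega>'"
| WhileFalse: "\<not> bval b s \<Longrightarrow> exec (While b c) s \<omega> 1 s \<omega>"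
| WhileTrue: "bval b s \<Longrightarrow> exec c s \<omega> t1 s1 \<omega>1 \<Longrightarrow> exec (While b c) s1 \<omega>1 t2 s2 \<omega>2 \<Longrightarrow>
    exec (While b c) s \<omega> (1 + t1 + t2) s2 \<omega>2"

inductive_cases SkipE: "exec Skip s \<omega> t s' \<omega>'"
inductive_cases AssignE: "exec (Assign a i e) s \<omega> t s' \<omega>'"
inductive_cases FlipE: "exec (Flip a i) s \<omega> t s' \<omega>'"
inductive_cases SeqE: "exec (Seq c1 c2) s \<omega> t s' \<omega>'"

lemma exec_deterministic:
  "exec c s \<omega> t s' \<omega>' \<Longrightarrow> exec c s \<omega> u s'' \<omega>'' \<Longrightarrow> t = u \<and> s' = s'' \<and> \<omega>' = \<omega>''"
proof (induction arbitrary: u s'' \<omega>'' rule: exec.induct)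
  case (Skip s \<omega>)
  then show ?case by (auto elim: SkipE)
next
  case (Assign a i e s \<omega>)
  then show ?case by (auto elim: AssignE)
next
  case (Flip a i s \<omega>)
  then show ?case by (auto elim: FlipE)
next
  case (Seq c1 s \<omega> t1 s1 \<omega>1 c2 t2 s2 \<omega>2)
  from Seq.prems obtain u1 r1 \<rho>1 u2 where
    *: "exec c1 s \<omega> u1 r1 \<rho>1" "exec c2 r1 \<rho>1 u2 s'' \<omega>''" "u = u1 + u2"
    by (rule SeqE)
  from Seq.IH(1)[OF *(1)] have "t1 = u1" "s1 = r1" "\<omega>1 = \<rho>1" by simp_all
  with Seq.IH(2)[of u2 s'' \<omega>''] * show ?case by simp
next
  case (IfTrue b s c1 \<omega> t s' \<omega>' c2)
  from IfTrue.prems IfTrue.hyps(1) obtain u' where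
    *: "exec c1 s \<omega> u' s'' \<omega>''" "u = 1 + u'"
    by (cases rule: exec.cases) auto
  from IfTrue.IH[OF *(1)] *(2) show ?case by simp
next
  case (IfFalse b s c2 \<omega> t s' \<omega>' c1)
  from IfFalse.prems IfFalse.hyps(1) obtain u' where
    *: "exec c2 s \<omega> u' s'' \<omega>''" "u = 1 + u'"
    by (cases rule: exec.cases) auto
  from IfFalse.IH[OF *(1)] *(2) show ?case by simp
next
  case (WhileFalse b s c \<omega>)
  from WhileFalse.prems WhileFalse.hyps show ?case
    by (cases rule: exec.cases) auto
next
  case (WhileTrue b s c \<omega> t1 s1 \<omega>1 t2 s2 \<omega>2)
  from WhileTrue.prems WhileTrue.hyps(1) obtain u1 r1 \<rho>1 u2 where
    *: "exec c s \<omega> u1 r1 \<rho>1" "exec (While b c) r1 \<rho>1 u2 s'' \<omega>''" "u = 1 + u1 + u2"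
    by (cases rule: exec.cases) auto
  from WhileTrue.IH(1)[OF *(1)] have "t1 = u1" "s1 = r1" "\<omega>1 = \<rho>1" by simp_all
  with WhileTrue.IH(2)[of u2 s'' \<omega>''] * show ?case by simp
qed

text \<open>The infimum is over at most one number, and is \<open>\<infinity>\<close> for a nonterminating run.\<close>

definition runtime :: "com \<Rightarrow> store \<Rightarrow> bool stream \<Rightarrow> ennreal" where
  "runtime c s \<omega> = Inf {of_nat t | t. \<exists>s' \<omega>'. exec c s \<omega> t s' \<omega>'}"

definition coin_space :: "bool stream measure" where
  "coin_space = stream_space (measure_pmf (bernoulli_pmf (1/2)))"

definition initial_store :: "nat list \<Rightarrow> store" where
  "initial_store xs = (\<lambda>a i. if a = ''in'' \<and> i < length xs then xs ! i else 0)"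

text \<open>On input \<open>xs\<close>, the randomized algorithm \<open>c\<close> terminates almost surely, its expected
  running time is at most \<open>B\<close>, and whenever it terminates, the content of the array \<open>out\<close>
  satisfies \<open>correct\<close>.\<close>

definition solves_in_expected_time ::
    "com \<Rightarrow> nat list \<Rightarrow> ((nat \<Rightarrow> nat) \<Rightarrow> bool) \<Rightarrow> ennreal \<Rightarrow> bool" where
  "solves_in_expected_time c xs correct B \<longleftrightarrow>
     (\<forall>\<omega> t s \<omega>'. exec c (initial_store xs) \<omega> t s \<omega>' \<longrightarrow> correct (s ''out'')) \<and>
     (AE \<omega> in coin_space. \<exists>t s \<omega>'. exec c (initial_store xs) \<omega> t s \<omega>') \<and>
     (\<integral>\<^sup>+ \<omega>. runtime c (initial_store xs) \<omega> \<partial>coin_space) \<le> B"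

text \<open>For computations, the vertices are \<open>0, \<dots>, n - 1\<close> and the hyperedges are given by a list
  \<open>es\<close> without repetitions of lists without repetitions.\<close>

definition edge_list :: "nat list list \<Rightarrow> nat set set \<Rightarrow> bool" where
  "edge_list es E \<longleftrightarrow> set ` set es = E \<and> distinct (map set es) \<and> (\<forall>e\<in>set es. distinct e)"

definition encode :: "nat \<Rightarrow> nat \<Rightarrow> nat list list \<Rightarrow> nat list" where
  "encode x n es = [x, n, length es] @ concat (map (\<lambda>e. length e # e) es)"

text \<open>The numbers \<open>x\<close> and \<open>n\<close> count in unary: the output consists of \<open>x * n\<close> bits.\<close>

definition input_size :: "nat \<Rightarrow> nat \<Rightarrow> nat list list \<Rightarrow> nat" where
  "input_size x n es = x + n + length (encode x n es)"

definition decode :: "nat \<Rightarrow> nat \<Rightarrow> (nat \<Rightarrow> nat) \<Rightarrow> (nat \<Rightarrow> nat) set" where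
  "decode x n out = (\<lambda>j. \<lambda>v\<in>{..<n}. out (j * n + v)) ` {..<x}"

end

theory Submission
  imports Defs
begin

text \<open>The method of conditional expectations makes the random choice deterministic, so no coin is
  tossed. Colour the vertices row by row and give a hyperedge the weight \<open>0\<close> once some row makes it
  non-monochromatic; otherwise every vertex of it that repeats the colour of the earlier ones in
  the current row doubles its weight. Each vertex gets the colour for which the
  weight that is doubled is at most the weight that is dropped, so that the total weight never
  exceeds the number of hyperedges. A hyperedge monochromatic in all \<open>x\<close> rows would end with weight
  \<open>2 ^ ((k - 1) * x)\<close>, which is larger than that. Repeated rows are then discarded and
  replaced by binary expansions of numbers below \<open>x\<close>, which are pairwise distinct if
  \<open>x \<le> 2 ^ n\<close>.\<close>

section \<open>Loop programs and their running time\<close>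

text \<open>For \<open>k > 0\<close> the weight of a hyperedge is \<open>2 ^ ((k - 1) * x)\<close>
  times the conditional probability that it ends up monochromatic in all \<open>x\<close> rows when
  the remaining colours are drawn uniformly. With this scaling every weight is an integer that
  starts at \<open>1\<close> and changes only by doubling or vanishing, which suits a machine that
  cannot multiply. The obstacle is the running time: a while-program need not terminate, and its
  cost depends on the run. The algorithm is therefore written in a language of counting loops whose
  bounds sit in the protected input. It has a total semantics, and its cost has a bound computed
  from the syntax alone that is polynomial in any bound on those entries.\<close>

datatype prog =
    Nop
  | Asg string aexp aexp
  | Then prog prog (infixr \<open>;;\<close> 60)
  | Cond bexp prog prog
  | For string nat prog

text \<open>The bound of a loop is always one of the four header entries \<open>x\<close>, \<open>n\<close>, \<open>m\<close>, \<open>k\<close> of the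
  input, where \<open>k\<close> is the size of the first hyperedge.\<close>

primrec compile :: "prog \<Rightarrow> com" where
  "compile Nop = Skip"
| "compile (Asg a i e) = Assign a i e"
| "compile (p ;; q) = Seq (compile p) (compile q)"
| "compile (Cond b p q) = If b (compile p) (compile q)"
| "compile (For i b p) = Seq (Assign i (N 0) (N 0))
     (While (Less (Arr i (N 0)) (Arr ''in'' (N b)))
       (Seq (compile p) (Assign i (N 0) (Plus (Arr i (N 0)) (N 1)))))"

primrec run :: "prog \<Rightarrow> store \<Rightarrow> store" where
  "run Nop s = s"
| "run (Asg a i e) s = update s a (aval i s) (aval e s)"
| "run (p ;; q) s = run q (run p s)"
| "run (Cond b p q) s = (if bval b s then run p s else run q s)"
| "run (For i b p) s =
     ((\<lambda>s. update (run p s) i 0 (Suc (run p s i 0))) ^^ s ''in'' b) (update s i 0 0)"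

primrec writes :: "prog \<Rightarrow> string set" where
  "writes Nop = {}"
| "writes (Asg a i e) = {a}"
| "writes (p ;; q) = writes p \<union> writes q"
| "writes (Cond b p q) = writes p \<union> writes q"
| "writes (For i b p) = insert i (writes p)"

text \<open>\<open>run\<close> fixes the number of iterations on entry, while the compiled loop
  tests its counter every time; the two agree because a body may touch neither the counter nor the
  input. The bound \<open>4\<close> confines loop bounds to the header.\<close>

primrec wf_prog :: "prog \<Rightarrow> bool" where
  "wf_prog Nop \<longleftrightarrow> True"
| "wf_prog (Asg a i e) \<longleftrightarrow> a \<noteq> ''in''"
| "wf_prog (p ;; q) \<longleftrightarrow> wf_prog p \<and> wf_prog q"
| "wf_prog (Cond b p q) \<longleftrightarrow> wf_prog p \<and> wf_prog q"
| "wf_prog (For i b p) \<longleftrightarrow> wf_prog p \<and> b < 4 \<and> i \<notin> writes p \<and> i \<noteq> ''in''"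

text \<open>A loop costs one step each for the initial assignment and the failing last test, and two
  per iteration for test and increment. Branches are added rather than maximised so that the result
  is a polynomial in \<open>L\<close>.\<close>

primrec time :: "prog \<Rightarrow> nat \<Rightarrow> nat" where
  "time Nop L = 1"
| "time (Asg a i e) L = 1"
| "time (p ;; q) L = time p L + time q L"
| "time (Cond b p q) L = 1 + (time p L + time q L)"
| "time (For i b p) L = 2 + L * (time p L + 2)"

lemma update_same [simp]: "update s a i v a = (s a)(i := v)"
  and update_other [simp]: "b \<noteq> a \<Longrightarrow> update s a i v b = s b"
  by (simp_all add: update_def)

lemma run_frame: "a \<notin> writes p \<Longrightarrow> run p s a = s a"
proof (induction p arbitrary: s)
  case (For i b p)
  have "((\<lambda>s. update (run p s) i 0 (Suc (run p s i 0))) ^^ j) (update s i 0 0) a = s a" for j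
    by (induction j) (use For in auto)
  then show ?case by (auto split: if_splits)
qed auto

lemma wf_prog_in: "wf_prog p \<Longrightarrow> ''in'' \<notin> writes p"
  by (induction p) auto

lemma run_in: "wf_prog p \<Longrightarrow> run p s ''in'' = s ''in''"
  by (simp add: run_frame wf_prog_in)

text \<open>The invariant rule for loops. Its step also hands over that arrays not written by the
  body still have their values from before the loop, so an invariant need mention only what
  changes.\<close>

lemma run_For:
  assumes wf: "wf_prog (For i b p)"
    and base: "I 0 (update s i 0 0)"
    and step: "\<And>j s'. j < s ''in'' b \<Longrightarrow> s' i 0 = j \<Longrightarrow>
      (\<And>a. a \<noteq> i \<Longrightarrow> a \<notin> writes p \<Longrightarrow> s' a = s a) \<Longrightarrow> I j s' \<Longrightarrow>
      I (Suc j) (update (run p s') i 0 (Suc j))"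
  shows "I (s ''in'' b) (run (For i b p) s)"
proof -
  define F where "F = (\<lambda>s. update (run p s) i 0 (Suc (run p s i 0)))"
  have "I j ((F ^^ j) (update s i 0 0)) \<and> (F ^^ j) (update s i 0 0) i 0 = j \<and>
    (\<forall>a. a \<noteq> i \<longrightarrow> a \<notin> writes p \<longrightarrow> (F ^^ j) (update s i 0 0) a = s a)" if "j \<le> s ''in'' b" for j
    using that
  proof (induction j)
    case 0
    then show ?case using base by simp
  next
    case (Suc j)
    define s' where "s' = (F ^^ j) (update s i 0 0)"
    have s': "I j s'" "s' i 0 = j" "\<And>a. a \<noteq> i \<Longrightarrow> a \<notin> writes p \<Longrightarrow> s' a = s a"
      using Suc by (auto simp: s'_def)
    have "run p s' i = s' i" using wf by (intro run_frame) simp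
    then have F: "F s' = update (run p s') i 0 (Suc j)"
      using s' by (simp add: F_def)
    have "I (Suc j) (F s')" unfolding F
      by (rule step) (use s' Suc.prems in auto)
    then show ?case
      using s' by (auto simp: F s'_def[symmetric] run_frame)
  qed
  from this[of "s ''in'' b"] show ?thesis by (simp add: F_def)
qed

declare run.simps(5) [simp del]

text \<open>No \<open>Flip\<close> is ever emitted, so every coin sequence \<omega> leads to the
  same store and is returned untouched.\<close>

lemma exec_compile:
  assumes "wf_prog p" "\<forall>b<4. s ''in'' b \<le> L"
  shows "\<exists>t\<le>time p L. exec (compile p) s \<omega> t (run p s) \<omega>"
  using assms
proof (induction p arbitrary: s)
  case Nop
  then show ?case using exec.Skip[of s \<omega>] by (intro exI[of _ 1]) simp
next
  case (Asg a i e)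
  then show ?case using exec.Assign[of a i e s \<omega>] by (intro exI[of _ 1]) simp
next
  case (Then p q)
  obtain t where t: "t \<le> time p L" "exec (compile p) s \<omega> t (run p s) \<omega>"
    using Then.IH(1)[of s] Then.prems by auto
  obtain u where u: "u \<le> time q L" "exec (compile q) (run p s) \<omega> u (run q (run p s)) \<omega>"
    using Then.IH(2)[of "run p s"] Then.prems by (auto simp: run_in)
  show ?case
    using t(1) u(1) exec.Seq[OF t(2) u(2)] by (intro exI[of _ "t + u"]) simp
next
  case (Cond b p q)
  obtain t where t: "t \<le> time p L" "exec (compile p) s \<omega> t (run p s) \<omega>"
    using Cond.IH(1)[of s] Cond.prems by auto
  obtain u where u: "u \<le> time q L" "exec (compile q) s \<omega> u (run q s) \<omega>"
    using Cond.IH(2)[of s] Cond.prems by auto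
  show ?case
  proof (cases "bval b s")
    case True
    then show ?thesis using t exec.IfTrue[OF True t(2)] by (intro exI[of _ "1 + t"]) simp
  next
    case False
    then show ?thesis using u exec.IfFalse[OF False u(2)] by (intro exI[of _ "1 + u"]) simp
  qed
next
  case (For i b p)
  define F where "F = (\<lambda>s. update (run p s) i 0 (Suc (run p s i 0)))"
  define W where "W = While (Less (Arr i (N 0)) (Arr ''in'' (N b)))
       (Seq (compile p) (Assign i (N 0) (Plus (Arr i (N 0)) (N 1))))"
  \<comment> \<open>Induction on the number \<open>d\<close> of iterations still to come: the rule
    for \<open>While\<close> splits off the first iteration, whereas \<open>F ^^ Suc d\<close>
    unfolds at the last one.\<close>
  have loop: "\<exists>t\<le>1 + d * (time p L + 2). exec W r \<omega> t ((F ^^ d) r) \<omega>"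
    if "r ''in'' = s ''in''" "r i 0 + d = s ''in'' b" for r d
    using that
  proof (induction d arbitrary: r)
    case 0
    have "exec W r \<omega> 1 r \<omega>"
      unfolding W_def by (rule exec.WhileFalse) (use 0 in auto)
    then show ?case by (intro exI[of _ 1]) simp
  next
    case (Suc d)
    obtain t where t: "t \<le> time p L" "exec (compile p) r \<omega> t (run p r) \<omega>"
      using For.IH[of r] For.prems Suc.prems by auto
    have ri: "run p r i = r i" "run p r ''in'' = s ''in''"
      using For.prems Suc.prems by (auto simp: run_frame run_in)
    have "exec (Assign i (N 0) (Plus (Arr i (N 0)) (N 1))) (run p r) \<omega> 1 (F r) \<omega>"
      using exec.Assign[of i "N 0" "Plus (Arr i (N 0)) (N 1)" "run p r" \<omega>] by (simp add: F_def)
    note body = exec.Seq[OF t(2) this]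
    have Fr: "F r ''in'' = s ''in''" "F r i 0 + d = s ''in'' b"
      using ri For.prems Suc.prems by (auto simp: F_def)
    obtain u where u: "u \<le> 1 + d * (time p L + 2)" "exec W (F r) \<omega> u ((F ^^ d) (F r)) \<omega>"
      using Suc.IH[OF Fr] by blast
    have "exec W r \<omega> (1 + (t + 1) + u) ((F ^^ d) (F r)) \<omega>"
      unfolding W_def
      by (rule exec.WhileTrue[OF _ body u(2)[unfolded W_def]]) (use Suc.prems in auto)
    then show ?case
      using t(1) u(1) by (intro exI[of _ "1 + (t + 1) + u"]) (simp add: funpow_swap1)
  qed
  obtain t where t: "t \<le> 1 + s ''in'' b * (time p L + 2)"
    "exec W (update s i 0 0) \<omega> t ((F ^^ s ''in'' b) (update s i 0 0)) \<omega>"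
    using loop[of "update s i 0 0" "s ''in'' b"] For.prems by auto
  have "exec (Assign i (N 0) (N 0)) s \<omega> 1 (update s i 0 0) \<omega>"
    using exec.Assign[of i "N 0" "N 0" s \<omega>] by simp
  from exec.Seq[OF this t(2)]
  have "exec (compile (For i b p)) s \<omega> (1 + t) (run (For i b p) s) \<omega>"
    by (simp add: run.simps(5) F_def W_def)
  moreover have "s ''in'' b * (time p L + 2) \<le> L * (time p L + 2)"
    using For.prems by (intro mult_right_mono) auto
  then have "1 + t \<le> time (For i b p) L" using t(1) by simp
  ultimately show ?case by blast
qed

lemma time_poly: "\<exists>P. \<forall>L. poly P L = time p L"
proof (induction p)
  case Nop
  then show ?case by (auto intro: exI[of _ 1])
next
  case (Asg a i e)
  then show ?case by (auto intro: exI[of _ 1])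
next
  case (Then p q)
  then obtain P Q where "\<forall>L. poly P L = time p L" "\<forall>L. poly Q L = time q L" by blast
  then show ?case by (intro exI[of _ "P + Q"]) simp
next
  case (Cond b p q)
  then obtain P Q where "\<forall>L. poly P L = time p L" "\<forall>L. poly Q L = time q L" by blast
  then show ?case by (intro exI[of _ "1 + (P + Q)"]) simp
next
  case (For i b p)
  then obtain P where "\<forall>L. poly P L = time p L" by blast
  then show ?case by (intro exI[of _ "[:2:] + [:0, 1:] * (P + [:2:])"]) simp
qed

text \<open>The time bound holds for every coin sequence, so its expectation over a probability
  space obeys it too. Determinism of \<open>exec\<close> transfers correctness from the run
  constructed above to any other terminating run.\<close>

lemma solves_in_expected_time_compile:
  assumes wf: "wf_prog p" and L: "\<forall>b<4. initial_store xs ''in'' b \<le> L"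
    and correct: "correct (run p (initial_store xs) ''out'')"
  shows "solves_in_expected_time (compile p) xs correct (of_nat (time p L))"
proof -
  interpret coin: prob_space coin_space
    unfolding coin_space_def
    by (intro prob_space.prob_space_stream_space) (rule measure_pmf.prob_space_axioms)
  have ex: "\<exists>t\<le>time p L. exec (compile p) (initial_store xs) \<omega> t (run p (initial_store xs)) \<omega>" for \<omega>
    using wf L by (rule exec_compile)
  have "runtime (compile p) (initial_store xs) \<omega> \<le> of_nat (time p L)" for \<omega>
  proof -
    obtain t where t: "t \<le> time p L"
      "exec (compile p) (initial_store xs) \<omega> t (run p (initial_store xs)) \<omega>"
      using ex by blast
    then have "runtime (compile p) (initial_store xs) \<omega> \<le> of_nat t"
      unfolding runtime_def by (intro Inf_lower) blast
    also have "\<dots> \<le> of_nat (time p L)" using t(1) by simp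
    finally show ?thesis .
  qed
  then have "(\<integral>\<^sup>+ \<omega>. runtime (compile p) (initial_store xs) \<omega> \<partial>coin_space) \<le>
      (\<integral>\<^sup>+ \<omega>. of_nat (time p L) \<partial>coin_space)"
    by (intro nn_integral_mono) auto
  also have "\<dots> = of_nat (time p L)" by (simp add: coin.emeasure_space_1)
  finally have "(\<integral>\<^sup>+ \<omega>. runtime (compile p) (initial_store xs) \<omega> \<partial>coin_space) \<le> of_nat (time p L)" .
  moreover have "correct (s ''out'')" if run: "exec (compile p) (initial_store xs) \<omega> t s \<omega>'" for \<omega> t s \<omega>'
  proof -
    obtain u where "exec (compile p) (initial_store xs) \<omega> u (run p (initial_store xs)) \<omega>"
      using ex by blast
    from exec_deterministic[OF run this] show ?thesis using correct by simp
  qed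
  moreover have "AE \<omega> in coin_space. \<exists>t s \<omega>'. exec (compile p) (initial_store xs) \<omega> t s \<omega>'"
    using ex by (intro AE_I2) blast
  ultimately show ?thesis
    unfolding solves_in_expected_time_def by blast
qed

section \<open>Appending a row\<close>

abbreviation var :: "string \<Rightarrow> aexp" where
  "var a \<equiv> Arr a (N 0)"

abbreviation set_var :: "string \<Rightarrow> aexp \<Rightarrow> prog" where
  "set_var a e \<equiv> Asg a (N 0) e"

abbreviation Eq :: "aexp \<Rightarrow> aexp \<Rightarrow> bexp" where
  "Eq e1 e2 \<equiv> And (Not (Less e1 e2)) (Not (Less e2 e1))"

abbreviation When :: "bexp \<Rightarrow> prog \<Rightarrow> prog" where
  "When b p \<equiv> Cond b p Nop"

text \<open>Row \<open>h\<close> of the output occupies the indices from \<open>h * n\<close> on. The scalars \<open>r\<close> and \<open>o\<close> hold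
  the number of finished rows and the start of the row under construction.\<close>

definition row :: "nat \<Rightarrow> (nat \<Rightarrow> nat) \<Rightarrow> nat \<Rightarrow> nat \<Rightarrow> nat" where
  "row n f h = (\<lambda>v\<in>{..<n}. f (h * n + v))"

definition compare_rows :: prog where
  "compare_rows =
     set_var ''f'' (N 1) ;;
     For ''u'' 1
       (When (Not (Eq (Arr ''out'' (Plus (var ''q'') (var ''u'')))
                      (Arr ''out'' (Plus (var ''o'') (var ''u'')))))
         (set_var ''f'' (N 0)))"

text \<open>Loop bounds must be header entries, so \<open>h\<close> runs up to \<open>x\<close> and
  the test \<open>h < r\<close> sits in the body; \<open>q\<close> follows \<open>h * n\<close> by
  repeated addition. A rejected row is not erased: \<open>o\<close> stays put and the next row
  overwrites it.\<close>

definition commit :: prog where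
  "commit =
     set_var ''d'' (N 0) ;;
     set_var ''q'' (N 0) ;;
     For ''h'' 0
       (compare_rows ;;
        When (And (Less (var ''h'') (var ''r'')) (Eq (var ''f'') (N 1))) (set_var ''d'' (N 1)) ;;
        set_var ''q'' (Plus (var ''q'') (Arr ''in'' (N 1)))) ;;
     When (Eq (var ''d'') (N 0))
       (set_var ''r'' (Plus (var ''r'') (N 1)) ;;
        set_var ''o'' (Plus (var ''o'') (Arr ''in'' (N 1))))"

lemma wf_compare_rows [simp]: "wf_prog compare_rows"
  and writes_compare_rows [simp]: "writes compare_rows = {''f'', ''u''}"
  by (auto simp: compare_rows_def)

lemma run_compare_rows:
  "run compare_rows s ''f'' 0 =
     of_bool (\<forall>u<s ''in'' 1. s ''out'' (s ''q'' 0 + u) = s ''out'' (s ''o'' 0 + u))"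
proof -
  define s0 where "s0 = update s ''f'' 0 1"
  define p where "p = When (Not (Eq (Arr ''out'' (Plus (var ''q'') (var ''u'')))
                      (Arr ''out'' (Plus (var ''o'') (var ''u'')))))
         (set_var ''f'' (N 0))"
  have "run (For ''u'' 1 p) s0 ''f'' 0 =
    of_bool (\<forall>u<s0 ''in'' 1. s ''out'' (s ''q'' 0 + u) = s ''out'' (s ''o'' 0 + u))"
    by (rule run_For[where I = "\<lambda>j s'. s' ''f'' 0 =
          of_bool (\<forall>u<j. s ''out'' (s ''q'' 0 + u) = s ''out'' (s ''o'' 0 + u))"])
      (auto simp: p_def s0_def less_Suc_eq)
  then show ?thesis by (simp add: compare_rows_def p_def s0_def)
qed

lemma wf_commit [simp]: "wf_prog commit"
  and writes_commit [simp]: "writes commit = {''d'', ''q'', ''h'', ''f'', ''u'', ''r'', ''o''}"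
  by (auto simp: commit_def)

lemma ex_less_Suc_conv: "(\<exists>h<Suc j. P h) \<longleftrightarrow> (\<exists>h<j. P h) \<or> P j"
  by (auto simp: less_Suc_eq)

lemma row_eq_iff: "row n f h = row n f g \<longleftrightarrow> (\<forall>v<n. f (h * n + v) = f (g * n + v))"
  by (auto simp: row_def fun_eq_iff)

lemma run_commit:
  assumes n: "s ''in'' 1 = n" and r: "s ''r'' 0 \<le> s ''in'' 0" and o: "s ''o'' 0 = s ''r'' 0 * n"
  defines "f \<equiv> s ''out''" and "b \<equiv> of_bool (row n (s ''out'') (s ''r'' 0) \<notin> row n (s ''out'') ` {..<s ''r'' 0})"
  shows "run commit s ''r'' 0 = s ''r'' 0 + b" and "run commit s ''o'' 0 = (s ''r'' 0 + b) * n"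
proof -
  define s0 where "s0 = update (update s ''d'' 0 0) ''q'' 0 0"
  define p where "p = compare_rows ;;
        When (And (Less (var ''h'') (var ''r'')) (Eq (var ''f'') (N 1))) (set_var ''d'' (N 1)) ;;
        set_var ''q'' (Plus (var ''q'') (Arr ''in'' (N 1)))"
  define s1 where "s1 = run (For ''h'' 0 p) s0"
  have "s1 ''d'' 0 = of_bool (\<exists>h<s0 ''in'' 0. h < s ''r'' 0 \<and> row n f h = row n f (s ''r'' 0)) \<and>
      s1 ''q'' 0 = s0 ''in'' 0 * n"
    unfolding s1_def
  proof (rule run_For[where I = "\<lambda>j s'. s' ''d'' 0 =
      of_bool (\<exists>h<j. h < s ''r'' 0 \<and> row n f h = row n f (s ''r'' 0)) \<and> s' ''q'' 0 = j * n"])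
    fix j s'
    assume *: "s' ''h'' 0 = j" "\<And>a. a \<noteq> ''h'' \<Longrightarrow> a \<notin> writes p \<Longrightarrow> s' a = s0 a"
      "s' ''d'' 0 = of_bool (\<exists>h<j. h < s ''r'' 0 \<and> row n f h = row n f (s ''r'' 0)) \<and> s' ''q'' 0 = j * n"
    have fr: "s' ''in'' = s ''in''" "s' ''out'' = f" "s' ''r'' = s ''r''" "s' ''o'' = s ''o''"
      using *(2) by (auto simp: p_def s0_def f_def)
    have f: "run compare_rows s' ''f'' 0 = of_bool (row n f j = row n f (s ''r'' 0))"
      using * n o by (simp add: run_compare_rows row_eq_iff fr)
    have "run p s' ''d'' 0 = (if j < s ''r'' 0 \<and> row n f j = row n f (s ''r'' 0) then 1 else s' ''d'' 0)"
      using *(1) by (simp add: p_def run_frame fr f)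
    moreover have "run p s' ''q'' 0 = s' ''q'' 0 + n"
      using n by (simp add: p_def run_frame fr)
    ultimately show "update (run p s') ''h'' 0 (Suc j) ''d'' 0 =
          of_bool (\<exists>h<Suc j. h < s ''r'' 0 \<and> row n f h = row n f (s ''r'' 0)) \<and>
        update (run p s') ''h'' 0 (Suc j) ''q'' 0 = Suc j * n"
      using *(3) by (simp add: ex_less_Suc_conv)
  qed (auto simp: p_def s0_def)
  \<comment> \<open>Since \<open>r\<close> is at most \<open>x\<close>, the loop up to
    \<open>x\<close> has met every finished row.\<close>
  moreover have "(\<exists>h<s ''in'' 0. h < s ''r'' 0 \<and> row n f h = row n f (s ''r'' 0)) \<longleftrightarrow>
      row n f (s ''r'' 0) \<in> row n f ` {..<s ''r'' 0}"
  proof -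
    have "h < s ''in'' 0" if "h < s ''r'' 0" for h
      using that r by linarith
    then show ?thesis
      unfolding image_iff by (metis lessThan_iff)
  qed
  ultimately have d: "s1 ''d'' 0 = 1 - b"
    by (simp add: b_def f_def s0_def)
  have fr: "s1 ''r'' = s ''r''" "s1 ''o'' = s ''o''" "s1 ''in'' = s ''in''"
    unfolding s1_def by (simp_all add: run_frame p_def s0_def)
  have "run commit s = run (When (Eq (var ''d'') (N 0))
       (set_var ''r'' (Plus (var ''r'') (N 1)) ;;
        set_var ''o'' (Plus (var ''o'') (Arr ''in'' (N 1))))) s1"
    by (simp add: commit_def s1_def s0_def p_def)
  moreover have "b = 0 \<or> b = 1" by (simp add: b_def)
  ultimately show "run commit s ''r'' 0 = s ''r'' 0 + b"
    and "run commit s ''o'' 0 = (s ''r'' 0 + b) * n"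
    using n o d by (auto simp: fr)
qed
section \<open>Colouring a row\<close>

text \<open>The array \<open>w\<close> contains the weights of the hyperedges. The entry of a hyperedge in \<open>c\<close> is \<open>0\<close> as
  long as none of its vertices is coloured in the current row, and \<open>b + 1\<close> if the first one got
  the colour \<open>b\<close>; \<open>A\<close> sums the weights of the hyperedges through the current vertex by this
  entry, and its index \<open>0\<close> is junk.\<close>

definition survey :: prog where
  "survey =
     Asg ''A'' (N 1) (N 0) ;;
     Asg ''A'' (N 2) (N 0) ;;
     set_var ''p'' (N 4) ;;
     For ''e'' 2
       (set_var ''f'' (N 0) ;;
        For ''i'' 3
          (When (Eq (Arr ''in'' (Plus (var ''p'') (var ''i''))) (var ''v'')) (set_var ''f'' (N 1))) ;;
        Asg ''g'' (var ''e'') (var ''f'') ;;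
        When (Eq (var ''f'') (N 1))
          (Asg ''A'' (Arr ''c'' (var ''e''))
            (Plus (Arr ''A'' (Arr ''c'' (var ''e''))) (Arr ''w'' (var ''e'')))) ;;
        set_var ''p'' (Plus (var ''p'') (Plus (Arr ''in'' (N 3)) (N 1))))"

definition recolor :: prog where
  "recolor =
     For ''e'' 2
       (When (Eq (Arr ''g'' (var ''e'')) (N 1))
         (Cond (Eq (Arr ''c'' (var ''e'')) (N 0))
           (Asg ''c'' (var ''e'') (Plus (var ''b'') (N 1)))
           (Cond (Eq (Arr ''c'' (var ''e'')) (Plus (var ''b'') (N 1)))
             (Asg ''w'' (var ''e'') (Plus (Arr ''w'' (var ''e'')) (Arr ''w'' (var ''e''))))
             (Asg ''w'' (var ''e'') (N 0)))))"

text \<open>Colour \<open>b\<close> doubles the weight summed in entry \<open>b + 1\<close> of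
  \<open>A\<close> and drops that in entry \<open>2 - b\<close>, so \<open>1\<close> is chosen only
  if entry \<open>2\<close> is strictly smaller than entry \<open>1\<close>.\<close>

definition color_vertex :: prog where
  "color_vertex =
     survey ;;
     set_var ''b'' (N 0) ;;
     When (Less (Arr ''A'' (N 2)) (Arr ''A'' (N 1))) (set_var ''b'' (N 1)) ;;
     Asg ''out'' (Plus (var ''o'') (var ''v'')) (var ''b'') ;;
     recolor"

lemma wf_survey [simp]: "wf_prog survey"
  and writes_survey [simp]: "writes survey = {''A'', ''p'', ''e'', ''f'', ''i'', ''g''}"
  by (auto simp: survey_def)

lemma wf_recolor [simp]: "wf_prog recolor"
  and writes_recolor [simp]: "writes recolor = {''e'', ''c'', ''w''}"
  by (auto simp: recolor_def)

lemma wf_color_vertex [simp]: "wf_prog color_vertex"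
  and writes_color_vertex [simp]:
    "writes color_vertex = {''A'', ''p'', ''e'', ''f'', ''i'', ''g'', ''c'', ''w'', ''b'', ''out''}"
  by (auto simp: color_vertex_def)

text \<open>Three header entries precede the blocks, each of which is a length followed by the
  vertices. Index \<open>3\<close> is thus the length of the first block, which serves as
  \<open>k\<close> for all of them, and \<open>4\<close> is the address of its first vertex.\<close>

definition in_edge :: "(nat \<Rightarrow> nat) \<Rightarrow> nat \<Rightarrow> nat \<Rightarrow> bool" where
  "in_edge f e v \<longleftrightarrow> (\<exists>i<f 3. f (4 + e * (f 3 + 1) + i) = v)"

lemma run_survey:
  fixes s :: store
  defines "f \<equiv> s ''in''" and "v \<equiv> s ''v'' 0"
  assumes a: "a \<in> {1, 2}"
  shows "run survey s ''A'' a = (\<Sum>e<f 2. if in_edge f e v \<and> s ''c'' e = a then s ''w'' e else 0)"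
    and "e < f 2 \<Longrightarrow> run survey s ''g'' e = of_bool (in_edge f e v)"
proof -
  define s0 where "s0 = update (update (update s ''A'' 1 0) ''A'' 2 0) ''p'' 0 4"
  define scan where "scan = When (Eq (Arr ''in'' (Plus (var ''p'') (var ''i''))) (var ''v'')) (set_var ''f'' (N 1))"
  define p where "p = set_var ''f'' (N 0) ;;
        For ''i'' 3 scan ;;
        Asg ''g'' (var ''e'') (var ''f'') ;;
        When (Eq (var ''f'') (N 1))
          (Asg ''A'' (Arr ''c'' (var ''e''))
            (Plus (Arr ''A'' (Arr ''c'' (var ''e''))) (Arr ''w'' (var ''e'')))) ;;
        set_var ''p'' (Plus (var ''p'') (Plus (Arr ''in'' (N 3)) (N 1)))"
  define I where "I = (\<lambda>j s'. s' ''p'' 0 = 4 + j * (f 3 + 1) \<and>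
      (\<forall>a\<in>{1, 2}. s' ''A'' a = (\<Sum>e<j. if in_edge f e v \<and> s ''c'' e = a then s ''w'' e else 0)) \<and>
      (\<forall>e<j. s' ''g'' e = of_bool (in_edge f e v)))"
  have "I (s0 ''in'' 2) (run (For ''e'' 2 p) s0)"
  proof (rule run_For)
    show "wf_prog (For ''e'' 2 p)" by (simp add: p_def scan_def)
    show "I 0 (update s0 ''e'' 0 0)" by (simp add: I_def s0_def)
  next
    fix j s'
    assume j: "s' ''e'' 0 = j" and fr0: "\<And>a. a \<noteq> ''e'' \<Longrightarrow> a \<notin> writes p \<Longrightarrow> s' a = s0 a"
      and I: "I j s'"
    have fr: "s' ''in'' = f" "s' ''v'' = s ''v''" "s' ''c'' = s ''c''" "s' ''w'' = s ''w''"
      by (simp_all add: fr0 p_def scan_def s0_def f_def)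
    define s1 where "s1 = update s' ''f'' 0 0"
    have "run (For ''i'' 3 scan) s1 ''f'' 0 = of_bool (\<exists>i<s1 ''in'' 3. f (s' ''p'' 0 + i) = v)"
    proof (rule run_For[where I = "\<lambda>j s''. s'' ''f'' 0 = of_bool (\<exists>i<j. f (s' ''p'' 0 + i) = v)"])
      fix j s''
      assume "s'' ''i'' 0 = j" "s'' ''f'' 0 = of_bool (\<exists>i<j. f (s' ''p'' 0 + i) = v)"
        and fr1: "\<And>a. a \<noteq> ''i'' \<Longrightarrow> a \<notin> writes scan \<Longrightarrow> s'' a = s1 a"
      moreover have "s'' ''in'' = f" "s'' ''p'' = s' ''p''" "s'' ''v'' 0 = v"
        by (simp_all add: fr1 scan_def s1_def fr v_def)
      ultimately show "update (run scan s'') ''i'' 0 (Suc j) ''f'' 0 =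
          of_bool (\<exists>i<Suc j. f (s' ''p'' 0 + i) = v)"
        by (simp add: scan_def ex_less_Suc_conv)
    qed (simp_all add: scan_def s1_def)
    then have g: "run (For ''i'' 3 scan) s1 ''f'' 0 = of_bool (in_edge f j v)"
      using I by (simp add: in_edge_def I_def s1_def fr)
    define s2 where "s2 = run (For ''i'' 3 scan) s1"
    have fr2: "s2 ''in'' = f" "s2 ''c'' = s ''c''" "s2 ''w'' = s ''w''" "s2 ''e'' = s' ''e''"
       "s2 ''A'' = s' ''A''" "s2 ''g'' = s' ''g''" "s2 ''p'' = s' ''p''"
      by (simp_all add: s2_def run_frame scan_def s1_def fr)
    define s3 where "s3 = run p s'"
    have s3: "s3 ''p'' 0 = s' ''p'' 0 + f 3 + 1" "s3 ''g'' = (s' ''g'')(j := of_bool (in_edge f j v))"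
      "s3 ''A'' = (if in_edge f j v then (s' ''A'')(s ''c'' j := s' ''A'' (s ''c'' j) + s ''w'' j) else s' ''A'')"
      using j g by (auto simp: s3_def p_def s1_def[symmetric] s2_def[symmetric] fr2)
    show "I (Suc j) (update (run p s') ''e'' 0 (Suc j))"
      using I unfolding I_def s3_def[symmetric]
      by (auto simp: s3 less_Suc_eq)
  qed
  moreover have "run survey s = run (For ''e'' 2 p) s0"
    by (simp add: survey_def p_def scan_def s0_def)
  ultimately show "run survey s ''A'' a = (\<Sum>e<f 2. if in_edge f e v \<and> s ''c'' e = a then s ''w'' e else 0)"
    and "e < f 2 \<Longrightarrow> run survey s ''g'' e = of_bool (in_edge f e v)"
    using a by (auto simp: I_def s0_def f_def)
qed

lemma run_recolor:
  fixes s :: store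
  assumes e: "e < s ''in'' 2"
  shows "run recolor s ''c'' e =
      (if s ''g'' e = 1 \<and> s ''c'' e = 0 then s ''b'' 0 + 1 else s ''c'' e)"
    and "run recolor s ''w'' e =
      (if s ''g'' e = 1 \<and> s ''c'' e \<noteq> 0 then if s ''c'' e = s ''b'' 0 + 1 then 2 * s ''w'' e else 0
       else s ''w'' e)"
proof -
  \<comment> \<open>Quantifying over all \<open>e\<close> records that entries from \<open>j\<close>
    on still have their old values, which the next iteration reads.\<close>
  define I where "I = (\<lambda>j s'. \<forall>e.
      s' ''c'' e = (if e < j \<and> s ''g'' e = 1 \<and> s ''c'' e = 0 then s ''b'' 0 + 1 else s ''c'' e) \<and>
      s' ''w'' e = (if e < j \<and> s ''g'' e = 1 \<and> s ''c'' e \<noteq> 0 then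
         if s ''c'' e = s ''b'' 0 + 1 then 2 * s ''w'' e else 0 else s ''w'' e))"
  have "I (s ''in'' 2) (run recolor s)"
    unfolding recolor_def
  proof (rule run_For)
    show "I 0 (update s ''e'' 0 0)" by (simp add: I_def)
  next
    fix j s'
    let ?p = "When (Eq (Arr ''g'' (var ''e'')) (N 1))
         (Cond (Eq (Arr ''c'' (var ''e'')) (N 0))
           (Asg ''c'' (var ''e'') (Plus (var ''b'') (N 1)))
           (Cond (Eq (Arr ''c'' (var ''e'')) (Plus (var ''b'') (N 1)))
             (Asg ''w'' (var ''e'') (Plus (Arr ''w'' (var ''e'')) (Arr ''w'' (var ''e''))))
             (Asg ''w'' (var ''e'') (N 0))))"
    assume j: "s' ''e'' 0 = j" and fr0: "\<And>a. a \<noteq> ''e'' \<Longrightarrow> a \<notin> writes ?p \<Longrightarrow> s' a = s a"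
      and I: "I j s'"
    have fr: "s' ''g'' = s ''g''" "s' ''b'' = s ''b''"
      by (simp_all add: fr0)
    have cw: "s' ''c'' j = s ''c'' j" "s' ''w'' j = s ''w'' j"
      using I by (simp_all add: I_def)
    have c: "run ?p s' ''c'' e = (if e = j then
        if s ''g'' j = 1 \<and> s ''c'' j = 0 then s ''b'' 0 + 1 else s ''c'' j else s' ''c'' e)" for e
      using cw by (auto simp: j fr)
    have w: "run ?p s' ''w'' e = (if e = j then
        if s ''g'' j = 1 \<and> s ''c'' j \<noteq> 0 then if s ''c'' j = s ''b'' 0 + 1 then 2 * s ''w'' j else 0
        else s ''w'' j else s' ''w'' e)" for e
      using cw by (auto simp: j fr)
    define t where "t = run ?p s'"
    show "I (Suc j) (update (run ?p s') ''e'' 0 (Suc j))"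
      unfolding I_def t_def[symmetric]
    proof (intro allI conjI)
      fix e
      have lt: "e < Suc j \<longleftrightarrow> e = j \<or> e < j" by auto
      show "update t ''e'' 0 (Suc j) ''c'' e =
          (if e < Suc j \<and> s ''g'' e = 1 \<and> s ''c'' e = 0 then s ''b'' 0 + 1 else s ''c'' e)"
        using I c[of e] unfolding I_def t_def[symmetric] lt by simp
      show "update t ''e'' 0 (Suc j) ''w'' e =
          (if e < Suc j \<and> s ''g'' e = 1 \<and> s ''c'' e \<noteq> 0 then
            if s ''c'' e = s ''b'' 0 + 1 then 2 * s ''w'' e else 0 else s ''w'' e)"
        using I w[of e] unfolding I_def t_def[symmetric] lt by simp
    qed
  qed simp
  then show "run recolor s ''c'' e =
      (if s ''g'' e = 1 \<and> s ''c'' e = 0 then s ''b'' 0 + 1 else s ''c'' e)"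
    and "run recolor s ''w'' e =
      (if s ''g'' e = 1 \<and> s ''c'' e \<noteq> 0 then if s ''c'' e = s ''b'' 0 + 1 then 2 * s ''w'' e else 0
       else s ''w'' e)"
    using e by (simp_all add: I_def)
qed

text \<open>Hides the scratch arrays \<open>A\<close> and \<open>g\<close>. All that matters later
  about the choice of \<open>b\<close> is the last inequality: the weight about to be doubled is at
  most the weight about to be dropped.\<close>

lemma run_color_vertex:
  fixes s :: store
  defines "f \<equiv> s ''in''" and "v \<equiv> s ''v'' 0"
  obtains b where "b = 0 \<or> b = 1"
    "run color_vertex s ''out'' = (s ''out'')(s ''o'' 0 + v := b)"
    "\<And>e. e < f 2 \<Longrightarrow> run color_vertex s ''c'' e =
       (if in_edge f e v \<and> s ''c'' e = 0 then b + 1 else s ''c'' e)"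
    "\<And>e. e < f 2 \<Longrightarrow> run color_vertex s ''w'' e =
       (if in_edge f e v \<and> s ''c'' e \<noteq> 0 then if s ''c'' e = b + 1 then 2 * s ''w'' e else 0
        else s ''w'' e)"
    "(\<Sum>e<f 2. if in_edge f e v \<and> s ''c'' e = b + 1 then s ''w'' e else 0) \<le>
       (\<Sum>e<f 2. if in_edge f e v \<and> s ''c'' e = 2 - b then s ''w'' e else 0)"
proof -
  define s1 where "s1 = run survey s"
  have fr1: "s1 ''out'' = s ''out''" "s1 ''o'' = s ''o''" "s1 ''v'' = s ''v''" "s1 ''in'' = f"
    "s1 ''c'' = s ''c''" "s1 ''w'' = s ''w''"
    by (simp_all add: s1_def run_frame f_def)
  define b :: nat where "b = of_bool (s1 ''A'' 2 < s1 ''A'' 1)"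
  define s2 where "s2 = update (update (update s1 ''b'' 0 0) ''b'' 0 b) ''out'' (s ''o'' 0 + v) b"
  have s: "run color_vertex s = run recolor s2"
    by (simp add: color_vertex_def s1_def[symmetric] s2_def b_def fr1 v_def update_def)
  have fr2: "s2 ''in'' = f" "s2 ''c'' = s ''c''" "s2 ''w'' = s ''w''" "s2 ''g'' = s1 ''g''" "s2 ''b'' 0 = b"
    by (simp_all add: s2_def fr1)
  show thesis
  proof (rule that)
    show "b = 0 \<or> b = 1" by (simp add: b_def)
    show "run color_vertex s ''out'' = (s ''out'')(s ''o'' 0 + v := b)"
    proof -
      have "run recolor s2 ''out'' = s2 ''out''"
        by (rule run_frame) simp
      also have "\<dots> = (s ''out'')(s ''o'' 0 + v := b)"
        by (simp add: s2_def fr1)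
      finally show ?thesis unfolding s .
    qed
    show "(\<Sum>e<f 2. if in_edge f e v \<and> s ''c'' e = b + 1 then s ''w'' e else 0) \<le>
       (\<Sum>e<f 2. if in_edge f e v \<and> s ''c'' e = 2 - b then s ''w'' e else 0)"
    proof -
      have A: "s1 ''A'' a = (\<Sum>e<f 2. if in_edge f e v \<and> s ''c'' e = a then s ''w'' e else 0)"
        if "a \<in> {1, 2}" for a
        using run_survey(1)[OF that, of s] unfolding s1_def f_def v_def .
      consider "b = 0" "s1 ''A'' 1 \<le> s1 ''A'' 2" | "b = 1" "s1 ''A'' 2 \<le> s1 ''A'' 1"
        by (cases "s1 ''A'' 2 < s1 ''A'' 1") (simp_all add: b_def)
      then show ?thesis
      proof cases
        case 1
        then show ?thesis using A[of 1] A[of 2] by simp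
      next
        case 2
        then have "b + 1 = 2" "2 - b = 1" by simp_all
        with 2 show ?thesis using A[of 1] A[of 2] by (simp only: insert_iff simp_thms)
      qed
    qed
  next
    fix e assume e: "e < f 2"
    have g: "s1 ''g'' e = of_bool (in_edge f e v)"
      using run_survey(2)[of 1 e s] e by (simp add: s1_def f_def v_def)
    show "run color_vertex s ''c'' e =
       (if in_edge f e v \<and> s ''c'' e = 0 then b + 1 else s ''c'' e)"
      "run color_vertex s ''w'' e =
       (if in_edge f e v \<and> s ''c'' e \<noteq> 0 then if s ''c'' e = b + 1 then 2 * s ''w'' e else 0
        else s ''w'' e)"
      using run_recolor[of e s2] e by (simp_all add: s fr2 g)
  qed
qed
text \<open>For \<open>F e \<inter> {..<v} = {}\<close> the exponent is a truncated \<open>0 - 1 = 0\<close>: the first vertex of a hyperedge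
  does not change its weight either.\<close>

definition greedy_inv ::
    "(nat \<Rightarrow> nat set) \<Rightarrow> nat \<Rightarrow> nat \<Rightarrow> (nat \<Rightarrow> nat) \<Rightarrow> (nat \<Rightarrow> nat) \<Rightarrow> (nat \<Rightarrow> nat) \<Rightarrow> (nat \<Rightarrow> nat) \<Rightarrow> bool" where
  "greedy_inv F m v w0 X c w \<longleftrightarrow> sum w {..<m} \<le> sum w0 {..<m} \<and>
     (\<forall>e<m. c e \<le> 2 \<and>
       (w e = 0 \<and> (w0 e = 0 \<or> \<not> monochromatic X (F e \<inter> {..<v})) \<or>
        w e = w0 e * 2 ^ (card (F e \<inter> {..<v}) - 1) \<and>
        (\<forall>u\<in>F e \<inter> {..<v}. c e = X u + 1) \<and> (F e \<inter> {..<v} = {} \<longrightarrow> c e = 0)))"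

lemma greedy_inv_0: "(\<And>e. e < m \<Longrightarrow> c e = 0) \<Longrightarrow> greedy_inv F m 0 w X c w"
  by (simp add: greedy_inv_def)

text \<open>The total grows by the weight of the hyperedges through \<open>v\<close> whose row
  colour is \<open>b\<close> and shrinks by the weight of those with the opposite colour; by
  \<open>le\<close> the loss is at least the gain.\<close>

lemma greedy_inv_Suc:
  assumes inv: "greedy_inv F m v w0 X c w" and b: "b = 0 \<or> b = 1"
    and X': "X' v = b" "\<And>u. u < v \<Longrightarrow> X' u = X u"
    and c': "\<And>e. e < m \<Longrightarrow> c' e = (if v \<in> F e \<and> c e = 0 then b + 1 else c e)"
    and w': "\<And>e. e < m \<Longrightarrow> w' e =
      (if v \<in> F e \<and> c e \<noteq> 0 then if c e = b + 1 then 2 * w e else 0 else w e)"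
    and le: "(\<Sum>e<m. if v \<in> F e \<and> c e = b + 1 then w e else 0) \<le>
      (\<Sum>e<m. if v \<in> F e \<and> c e = 2 - b then w e else 0)"
  shows "greedy_inv F m (Suc v) w0 X' c' w'"
proof -
  have c2: "c e \<le> 2" if "e < m" for e using inv that by (simp add: greedy_inv_def)
  \<comment> \<open>Gain and loss are put on opposite sides to avoid truncated subtraction. The
    invariant says nothing else about \<open>c e\<close> for a dead hyperedge, which is why
    \<open>c e \<le> 2\<close> is a separate part of it.\<close>
  have "w' e + (if v \<in> F e \<and> c e = 2 - b then w e else 0) =
      w e + (if v \<in> F e \<and> c e = b + 1 then w e else 0)" if e: "e < m" for e
  proof -
    have "c e = 0 \<or> c e = 1 \<or> c e = 2" using c2[OF e] by linarith
    then show ?thesis using b by (elim disjE) (simp_all add: w'[OF e])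
  qed
  then have "(\<Sum>e<m. w' e + (if v \<in> F e \<and> c e = 2 - b then w e else 0)) =
      (\<Sum>e<m. w e + (if v \<in> F e \<and> c e = b + 1 then w e else 0))"
    by (intro sum.cong) auto
  then have "sum w' {..<m} \<le> sum w {..<m}"
    using le by (simp add: sum.distrib)
  then have "sum w' {..<m} \<le> sum w0 {..<m}"
    using inv by (simp add: greedy_inv_def)
  moreover have "c' e \<le> 2 \<and>
       (w' e = 0 \<and> (w0 e = 0 \<or> \<not> monochromatic X' (F e \<inter> {..<Suc v})) \<or>
        w' e = w0 e * 2 ^ (card (F e \<inter> {..<Suc v}) - 1) \<and>
        (\<forall>u\<in>F e \<inter> {..<Suc v}. c' e = X' u + 1) \<and> (F e \<inter> {..<Suc v} = {} \<longrightarrow> c' e = 0))"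
    if e: "e < m" for e
  proof (intro conjI)
    show "c' e \<le> 2" using c'[OF e] c2[OF e] b by auto
    define T where "T = F e \<inter> {..<v}"
    have fin: "finite T" "v \<notin> T" by (simp_all add: T_def)
    have T: "F e \<inter> {..<Suc v} = (if v \<in> F e then insert v T else T)"
      by (auto simp: T_def less_Suc_eq)
    have XT: "X' u = X u" if "u \<in> T" for u using that X' by (simp add: T_def)
    have sub: "\<not> monochromatic X' (F e \<inter> {..<Suc v})" if nm: "\<not> monochromatic X T"
    proof -
      obtain u u' where u: "u \<in> T" "u' \<in> T" "X u \<noteq> X u'"
        using nm by (auto simp: monochromatic_def)
      then have "u \<in> F e \<inter> {..<Suc v}" "u' \<in> F e \<inter> {..<Suc v}" "X' u \<noteq> X' u'"
        by (simp_all add: T XT)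
      then show ?thesis by (auto simp: monochromatic_def)
    qed
    have inv': "w e = 0 \<and> (w0 e = 0 \<or> \<not> monochromatic X T) \<or>
        w e = w0 e * 2 ^ (card T - 1) \<and> (\<forall>u\<in>T. c e = X u + 1) \<and> (T = {} \<longrightarrow> c e = 0)"
      using inv e by (simp add: greedy_inv_def T_def)
    \<comment> \<open>The case \<open>dead\<close> includes hyperedges settled by an earlier row,
      which enter this row with \<open>w0 e = 0\<close>.\<close>
    consider (dead) "w e = 0" "w0 e = 0 \<or> \<not> monochromatic X T"
      | (out) "v \<notin> F e" "w e = w0 e * 2 ^ (card T - 1)" "\<forall>u\<in>T. c e = X u + 1" "T = {} \<longrightarrow> c e = 0"
      | (first) "v \<in> F e" "w e = w0 e" "T = {}" "c e = 0"
      | (more) "v \<in> F e" "w e = w0 e * 2 ^ (card T - 1)" "\<forall>u\<in>T. c e = X u + 1" "T \<noteq> {}"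
      using inv' by (cases "T = {}") auto
    then show "w' e = 0 \<and> (w0 e = 0 \<or> \<not> monochromatic X' (F e \<inter> {..<Suc v})) \<or>
        w' e = w0 e * 2 ^ (card (F e \<inter> {..<Suc v}) - 1) \<and>
        (\<forall>u\<in>F e \<inter> {..<Suc v}. c' e = X' u + 1) \<and> (F e \<inter> {..<Suc v} = {} \<longrightarrow> c' e = 0)"
    proof cases
      case dead
      then show ?thesis using sub w'[OF e] by auto
    next
      case out
      then show ?thesis using XT w'[OF e] c'[OF e] by (simp add: T)
    next
      case first
      then show ?thesis using X' w'[OF e] c'[OF e] by (simp add: T)
    next
      case more
      then obtain u where u: "u \<in> T" "c e = X u + 1" by blast
      show ?thesis
      proof (cases "c e = b + 1")
        case True
        \<comment> \<open>With \<open>T\<close> nonempty, the truncated exponent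
          \<open>card T - 1\<close> really grows by one when \<open>v\<close> joins
          \<open>T\<close>.\<close>
        have "card T \<noteq> 0" using more fin by simp
        then have "2 ^ card T = 2 * (2::nat) ^ (card T - 1)"
          by (cases "card T") simp_all
        then show ?thesis
          using more True fin XT X' w'[OF e] c'[OF e] by (simp add: T)
      next
        case False
        then have "X' u \<noteq> X' v" using u XT X' by simp
        then have "\<not> monochromatic X' (F e \<inter> {..<Suc v})"
          using u(1) more(1) unfolding T by (auto simp: monochromatic_def)
        moreover have "w' e = 0" using False more(1) u(2) w'[OF e] by simp
        ultimately show ?thesis by simp
      qed
    qed
  qed
  ultimately show ?thesis by (simp add: greedy_inv_def)
qed

section \<open>Colouring a complete row\<close>

definition color_row :: prog where
  "color_row = For ''e'' 2 (Asg ''c'' (var ''e'') (N 0)) ;; For ''v'' 1 color_vertex"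

lemma wf_color_row [simp]: "wf_prog color_row"
  and writes_color_row [simp]:
    "writes color_row = {''A'', ''p'', ''e'', ''f'', ''i'', ''g'', ''c'', ''w'', ''b'', ''out'', ''v''}"
  by (auto simp: color_row_def)

text \<open>Allows a slice of the output array to be exchanged for the extensional
  \<open>row\<close>, which agrees with it only on vertices.\<close>

lemma greedy_inv_cong:
  assumes "greedy_inv F m v w0 X c w" "\<And>u. u < v \<Longrightarrow> X' u = X u"
  shows "greedy_inv F m v w0 X' c w"
proof -
  have "monochromatic X' (F e \<inter> {..<v}) = monochromatic X (F e \<inter> {..<v})" for e
    using assms(2) by (auto simp: monochromatic_def)
  then show ?thesis using assms by (simp add: greedy_inv_def)
qed

text \<open>Vertex \<open>v\<close> writes only to cell \<open>o' + v\<close>, so everything before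
  \<open>o'\<close>, and with it every finished row, survives.\<close>

lemma run_color_row:
  fixes s :: store
  defines "f \<equiv> s ''in''" and "o' \<equiv> s ''o'' 0" and "s' \<equiv> run color_row s"
  assumes F: "\<And>e v. e < f 2 \<Longrightarrow> v < f 1 \<Longrightarrow> in_edge f e v \<longleftrightarrow> v \<in> F e"
    and bits: "\<And>i. s ''out'' i \<le> 1"
  shows "greedy_inv F (f 2) (f 1) (s ''w'') (\<lambda>u. s' ''out'' (o' + u)) (s' ''c'') (s' ''w'')"
    and "\<And>i. i < o' \<Longrightarrow> s' ''out'' i = s ''out'' i"
    and "\<And>i. s' ''out'' i \<le> 1"
proof -
  define s0 where "s0 = run (For ''e'' 2 (Asg ''c'' (var ''e'') (N 0))) s"
  have fr0: "s0 ''in'' = f" "s0 ''out'' = s ''out''" "s0 ''o'' = s ''o''" "s0 ''w'' = s ''w''"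
    by (simp_all add: s0_def run_frame f_def)
  have "\<forall>e<s ''in'' 2. s0 ''c'' e = 0"
    unfolding s0_def
    by (rule run_For[where I = "\<lambda>j s'. \<forall>e<j. s' ''c'' e = 0"]) (auto simp: less_Suc_eq)
  then have c0: "s0 ''c'' e = 0" if "e < f 2" for e using that by (simp add: f_def)
  define I where "I = (\<lambda>v s'. greedy_inv F (f 2) v (s ''w'') (\<lambda>u. s' ''out'' (o' + u)) (s' ''c'') (s' ''w'') \<and>
    (\<forall>i<o'. s' ''out'' i = s ''out'' i) \<and> (\<forall>i. s' ''out'' i \<le> (1::nat)))"
  have "I (s0 ''in'' 1) (run (For ''v'' 1 color_vertex) s0)"
  proof (rule run_For)
    show "I 0 (update s0 ''v'' 0 0)"
      using c0 bits by (simp add: I_def fr0 greedy_inv_0)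
  next
    fix v r
    assume v: "v < s0 ''in'' 1" "r ''v'' 0 = v" and I: "I v r"
      and fr1: "\<And>a. a \<noteq> ''v'' \<Longrightarrow> a \<notin> writes color_vertex \<Longrightarrow> r a = s0 a"
    have fr: "r ''in'' = f" "r ''o'' = s ''o''"
      by (simp_all add: fr1 fr0)
    obtain b where b: "b = 0 \<or> b = 1"
      and out: "run color_vertex r ''out'' = (r ''out'')(o' + v := b)"
      and c: "\<And>e. e < f 2 \<Longrightarrow> run color_vertex r ''c'' e =
         (if in_edge f e v \<and> r ''c'' e = 0 then b + 1 else r ''c'' e)"
      and w: "\<And>e. e < f 2 \<Longrightarrow> run color_vertex r ''w'' e =
         (if in_edge f e v \<and> r ''c'' e \<noteq> 0 then if r ''c'' e = b + 1 then 2 * r ''w'' e else 0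
          else r ''w'' e)"
      and le: "(\<Sum>e<f 2. if in_edge f e v \<and> r ''c'' e = b + 1 then r ''w'' e else 0) \<le>
         (\<Sum>e<f 2. if in_edge f e v \<and> r ''c'' e = 2 - b then r ''w'' e else 0)"
    proof -
      note * = run_color_vertex[of r, unfolded fr v(2), folded o'_def]
      show thesis by (rule *, rule that, assumption+)
    qed
    have F': "in_edge f e v \<longleftrightarrow> v \<in> F e" if "e < f 2" for e
      using F[OF that] v fr0 by simp
    have "greedy_inv F (f 2) (Suc v) (s ''w'') (\<lambda>u. run color_vertex r ''out'' (o' + u))
        (run color_vertex r ''c'') (run color_vertex r ''w'')"
    proof (rule greedy_inv_Suc[OF _ b])
      show "greedy_inv F (f 2) v (s ''w'') (\<lambda>u. r ''out'' (o' + u)) (r ''c'') (r ''w'')"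
        using I by (simp add: I_def)
      show "(\<Sum>e<f 2. if v \<in> F e \<and> r ''c'' e = b + 1 then r ''w'' e else 0) \<le>
         (\<Sum>e<f 2. if v \<in> F e \<and> r ''c'' e = 2 - b then r ''w'' e else 0)"
        using le by (simp add: F')
    qed (simp_all add: out c w F')
    moreover have "\<forall>i<o'. run color_vertex r ''out'' i = s ''out'' i"
      using I by (simp add: I_def out)
    moreover have "\<forall>i. run color_vertex r ''out'' i \<le> 1"
      using I b by (auto simp: I_def out)
    ultimately show "I (Suc v) (update (run color_vertex r) ''v'' 0 (Suc v))"
      by (simp add: I_def)
  qed simp
  moreover have "s' = run (For ''v'' 1 color_vertex) s0"
    by (simp add: s'_def color_row_def s0_def)
  ultimately show "greedy_inv F (f 2) (f 1) (s ''w'') (\<lambda>u. s' ''out'' (o' + u)) (s' ''c'') (s' ''w'')"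
    and "\<And>i. i < o' \<Longrightarrow> s' ''out'' i = s ''out'' i"
    and "\<And>i. s' ''out'' i \<le> 1"
    by (simp_all add: I_def fr0)
qed

section \<open>Finished rows and removal of duplicates\<close>

definition rows :: "nat \<Rightarrow> store \<Rightarrow> (nat \<Rightarrow> nat) set" where
  "rows n s = row n (s ''out'') ` {..<s ''r'' 0}"

text \<open>The bound on \<open>out\<close> includes cells beyond the finished rows, because
  \<open>decode\<close> reads \<open>x\<close> rows even when fewer are finished.\<close>

definition rows_inv :: "nat \<Rightarrow> store \<Rightarrow> bool" where
  "rows_inv n s \<longleftrightarrow> s ''o'' 0 = s ''r'' 0 * n \<and> (\<forall>i. s ''out'' i \<le> 1) \<and>
     inj_on (row n (s ''out'')) {..<s ''r'' 0}"

lemma rows_inv_update: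
  assumes "a \<notin> {''o'', ''out'', ''r''}"
  shows "rows_inv n (update s a i v) = rows_inv n s" and "rows n (update s a i v) = rows n s"
  using assms by (auto simp: rows_inv_def rows_def)

lemma row_cong: "(\<And>i. i < r * n \<Longrightarrow> f i = g i) \<Longrightarrow> h < r \<Longrightarrow> row n f h = row n g h"
proof -
  assume fg: "\<And>i. i < r * n \<Longrightarrow> f i = g i" and h: "h < r"
  have "h * n + v < r * n" if "v < n" for v
  proof -
    have "h * n + v < Suc h * n" using that by simp
    also have "\<dots> \<le> r * n" using h by (intro mult_right_mono) auto
    finally show ?thesis .
  qed
  then show ?thesis using fg by (auto simp: row_def)
qed

text \<open>A rejected row is already among the finished ones, so in either case the set of finished
  rows gains the new row, and discarding duplicates cannot spoil a cover.\<close>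

lemma commit_rows:
  fixes s s1 :: store
  defines "s2 \<equiv> run commit s1"
  assumes inv: "rows_inv n s" and n: "s1 ''in'' 1 = n" and r: "s1 ''r'' = s ''r''" "s ''r'' 0 \<le> s1 ''in'' 0"
    and o: "s1 ''o'' = s ''o''" and bits: "\<And>i. s1 ''out'' i \<le> 1"
    and out: "\<And>i. i < s ''o'' 0 \<Longrightarrow> s1 ''out'' i = s ''out'' i"
  shows "rows_inv n s2" and "rows n s2 = insert (row n (s1 ''out'') (s ''r'' 0)) (rows n s)"
    and "s2 ''r'' 0 \<le> s ''r'' 0 + 1"
proof -
  define X where "X = row n (s1 ''out'') (s ''r'' 0)"
  have o': "s1 ''o'' 0 = s1 ''r'' 0 * n" using inv o r by (simp add: rows_inv_def)
  have row: "row n (s1 ''out'') h = row n (s ''out'') h" if "h < s ''r'' 0" for h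
    using inv out that by (intro row_cong[of "s ''r'' 0"]) (simp_all add: rows_inv_def)
  then have rows: "row n (s1 ''out'') ` {..<s ''r'' 0} = rows n s"
    unfolding rows_def by (intro image_cong) auto
  have inj: "inj_on (row n (s1 ''out'')) {..<s ''r'' 0}"
    using inv row by (simp add: rows_inv_def inj_on_def)
  have out2: "s2 ''out'' = s1 ''out''" by (simp add: s2_def run_frame)
  note commit = run_commit[of s1 n, OF n _ o', unfolded r, OF r(2), folded s2_def, unfolded rows X_def[symmetric]]
  have "rows_inv n s2 \<and> rows n s2 = insert X (rows n s) \<and> s2 ''r'' 0 \<le> s ''r'' 0 + 1"
  proof (cases "X \<in> rows n s")
    case True
    then have "s2 ''r'' 0 = s ''r'' 0" "s2 ''o'' 0 = s ''r'' 0 * n"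
      using commit by simp_all
    then show ?thesis
      using True inj bits rows by (auto simp: rows_inv_def out2 rows_def[of n s2])
  next
    case False
    then have r2: "s2 ''r'' 0 = Suc (s ''r'' 0)" and o2: "s2 ''o'' 0 = Suc (s ''r'' 0) * n"
      using commit by simp_all
    have "rows n s2 = insert X (rows n s)"
      using rows by (simp add: rows_def[of n s2] r2 out2 lessThan_Suc X_def)
    moreover have "inj_on (row n (s1 ''out'')) {..<Suc (s ''r'' 0)}"
      using inj False rows by (auto simp: lessThan_Suc X_def)
    ultimately show ?thesis
      using bits o2 by (simp add: rows_inv_def out2 r2)
  qed
  then show "rows_inv n s2" "rows n s2 = insert (row n (s1 ''out'') (s ''r'' 0)) (rows n s)"
    "s2 ''r'' 0 \<le> s ''r'' 0 + 1" by (simp_all add: X_def)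
qed
section \<open>The two phases\<close>

text \<open>Weights are initialised once and persist from row to row, whereas
  \<open>color_row\<close> resets \<open>c\<close>.\<close>

definition phase1 :: prog where
  "phase1 = For ''e'' 2 (Asg ''w'' (var ''e'') (N 1)) ;; For ''j'' 0 (color_row ;; commit)"

text \<open>With \<open>H = 2 ^ n\<close>, doubling \<open>t\<close> and reducing it modulo \<open>H\<close> yields the bits of \<open>j\<close> from the most
  significant one on.\<close>

definition expand :: prog where
  "expand =
     set_var ''t'' (var ''j'') ;;
     For ''v'' 1
       (set_var ''t'' (Plus (var ''t'') (var ''t'')) ;;
        Cond (Less (var ''t'') (var ''H''))
          (Asg ''out'' (Plus (var ''o'') (var ''v'')) (N 0))
          (Asg ''out'' (Plus (var ''o'') (var ''v'')) (N 1) ;;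
           set_var ''t'' (Minus (var ''t'') (var ''H''))))"

text \<open>Loops have no early exit, so the guard skips the remaining candidates once
  \<open>x\<close> rows are finished.\<close>

definition phase2 :: prog where
  "phase2 =
     set_var ''H'' (N 1) ;;
     For ''v'' 1 (set_var ''H'' (Plus (var ''H'') (var ''H''))) ;;
     For ''j'' 0 (When (Less (var ''r'') (Arr ''in'' (N 0))) (expand ;; commit))"

lemma wf_phase1 [simp]: "wf_prog phase1"
  by (simp add: phase1_def)

lemma wf_expand [simp]: "wf_prog expand"
  and writes_expand [simp]: "writes expand = {''t'', ''v'', ''out''}"
  by (auto simp: expand_def)

lemma wf_phase2 [simp]: "wf_prog phase2"
  by (simp add: phase2_def)

text \<open>A zero weight always comes with a witness among the finished rows, which persists
  because rows are only added. At the end \<open>few\<close> leaves no room for a nonzero weight,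
  since each weight is at most the total.\<close>

lemma run_phase1:
  fixes s :: store
  defines "f \<equiv> s ''in''" and "s' \<equiv> run phase1 s"
  assumes F: "\<And>e v. e < f 2 \<Longrightarrow> v < f 1 \<Longrightarrow> in_edge f e v \<longleftrightarrow> v \<in> F e"
    and sub: "\<And>e. e < f 2 \<Longrightarrow> F e \<subseteq> {..<f 1}" and card: "\<And>e. e < f 2 \<Longrightarrow> card (F e) = k"
    and inv: "rows_inv (f 1) s" and r: "s ''r'' 0 = 0"
    and few: "f 2 < 2 ^ ((k - 1) * f 0)"
  shows "rows_inv (f 1) s'" and "s' ''r'' 0 \<le> f 0"
    and "e < f 2 \<Longrightarrow> \<exists>X\<in>rows (f 1) s'. \<not> monochromatic X (F e)"
proof -
  define s0 where "s0 = run (For ''e'' 2 (Asg ''w'' (var ''e'') (N 1))) s"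
  have fr0: "s0 ''in'' = f" "s0 ''out'' = s ''out''" "s0 ''o'' = s ''o''" "s0 ''r'' = s ''r''"
    by (simp_all add: s0_def run_frame f_def)
  have "\<forall>e<s ''in'' 2. s0 ''w'' e = 1"
    unfolding s0_def
    by (rule run_For[where I = "\<lambda>j s'. \<forall>e<j. s' ''w'' e = 1"]) (auto simp: less_Suc_eq)
  then have w0: "s0 ''w'' e = 1" if "e < f 2" for e using that by (simp add: f_def)
  \<comment> \<open>The number of finished rows may lag behind \<open>j\<close>, as duplicates are
    rejected.\<close>
  define I where "I = (\<lambda>j s'. rows_inv (f 1) s' \<and> s' ''r'' 0 \<le> j \<and> sum (s' ''w'') {..<f 2} \<le> f 2 \<and>
    (\<forall>e<f 2. s' ''w'' e = 0 \<and> (\<exists>X\<in>rows (f 1) s'. \<not> monochromatic X (F e)) \<or>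
      s' ''w'' e = 2 ^ ((k - 1) * j)))"
  have "I (s0 ''in'' 0) (run (For ''j'' 0 (color_row ;; commit)) s0)"
  proof (rule run_For)
    show "I 0 (update s0 ''j'' 0 0)"
      using inv r w0 by (simp add: I_def rows_inv_update) (simp add: rows_inv_def fr0)
  next
    fix j q
    assume j: "j < s0 ''in'' 0" and I: "I j q"
      and fr1: "\<And>a. a \<noteq> ''j'' \<Longrightarrow> a \<notin> writes (color_row ;; commit) \<Longrightarrow> q a = s0 a"
    have q: "q ''in'' = f" by (simp add: fr1 fr0)
    have inv_q: "rows_inv (f 1) q" and rj: "q ''r'' 0 \<le> j" and le_q: "sum (q ''w'') {..<f 2} \<le> f 2"
      using I by (simp_all add: I_def)
    define q1 where "q1 = run color_row q"
    define q2 where "q2 = run commit q1"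
    define X where "X = row (f 1) (q1 ''out'') (q ''r'' 0)"
    have frq: "q1 ''in'' = f" "q1 ''r'' = q ''r''" "q1 ''o'' = q ''o''"
      by (simp_all add: q1_def run_frame q)
    have o: "q ''o'' 0 = q ''r'' 0 * f 1" and bits: "\<And>i. q ''out'' i \<le> 1"
      using inv_q by (simp_all add: rows_inv_def)
    note color = run_color_row[of q F, unfolded q, OF F bits, folded q1_def]
    have "greedy_inv F (f 2) (f 1) (q ''w'') X (q1 ''c'') (q1 ''w'')"
      by (rule greedy_inv_cong[OF color(1)]) (simp_all add: X_def row_def o)
    \<comment> \<open>After the last vertex the coloured part is the whole hyperedge, so a survivor
      has gained exactly the factor \<open>2 ^ (k - 1)\<close> in this row.\<close>
    moreover have "F e \<inter> {..<f 1} = F e" if "e < f 2" for e using sub[OF that] by auto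
    ultimately have le1: "sum (q1 ''w'') {..<f 2} \<le> sum (q ''w'') {..<f 2}"
      and w1: "\<And>e. e < f 2 \<Longrightarrow> q1 ''w'' e = 0 \<and> (q ''w'' e = 0 \<or> \<not> monochromatic X (F e)) \<or>
        q1 ''w'' e = q ''w'' e * 2 ^ (k - 1)"
      using card by (auto simp: greedy_inv_def)
    have commit: "rows_inv (f 1) q2" "rows (f 1) q2 = insert X (rows (f 1) q)" "q2 ''r'' 0 \<le> q ''r'' 0 + 1"
      using commit_rows[of "f 1" q q1, folded q2_def X_def] inv_q frq rj j color(2,3) fr0 by simp_all
    have w2: "q2 ''w'' = q1 ''w''" by (simp add: q2_def run_frame)
    have "q2 ''w'' e = 0 \<and> (\<exists>X\<in>rows (f 1) q2. \<not> monochromatic X (F e)) \<or>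
        q2 ''w'' e = 2 ^ ((k - 1) * Suc j)" if e: "e < f 2" for e
    proof -
      have p: "(2::nat) ^ ((k - 1) * Suc j) = 2 ^ ((k - 1) * j) * 2 ^ (k - 1)"
        by (simp add: power_add)
      have "q ''w'' e = 0 \<and> (\<exists>X\<in>rows (f 1) q. \<not> monochromatic X (F e)) \<or>
          q ''w'' e = 2 ^ ((k - 1) * j)"
        using I e by (simp add: I_def)
      then show ?thesis
      proof
        assume "q ''w'' e = 0 \<and> (\<exists>X\<in>rows (f 1) q. \<not> monochromatic X (F e))"
        moreover from this have "q1 ''w'' e = 0" using w1[OF e] by simp
        ultimately show ?thesis unfolding w2 commit(2) by blast
      next
        assume w: "q ''w'' e = 2 ^ ((k - 1) * j)"
        from w1[OF e] show ?thesis
        proof (elim disjE conjE)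
          assume "q ''w'' e = 0"
          then show ?thesis using w by simp
        next
          assume "\<not> monochromatic X (F e)"
          moreover have "X \<in> rows (f 1) q2"
            unfolding commit(2) by (rule insertI1)
          moreover assume "q1 ''w'' e = 0"
          ultimately show ?thesis unfolding w2 by (intro disjI1 conjI bexI)
        next
          assume "q1 ''w'' e = q ''w'' e * 2 ^ (k - 1)"
          then show ?thesis by (simp only: w2 p w simp_thms)
        qed
      qed
    qed
    then have "I (Suc j) q2"
      using commit rj le1 le_q by (simp add: I_def w2)
    moreover have "run (color_row ;; commit) q = q2" by (simp add: q1_def q2_def)
    ultimately show "I (Suc j) (update (run (color_row ;; commit) q) ''j'' 0 (Suc j))"
      by (simp add: I_def rows_inv_update)
  qed simp
  moreover have "s' = run (For ''j'' 0 (color_row ;; commit)) s0"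
    by (simp add: s'_def phase1_def s0_def)
  ultimately have I: "I (f 0) s'" by (simp add: fr0)
  then show "rows_inv (f 1) s'" and "s' ''r'' 0 \<le> f 0"
    by (simp_all add: I_def)
  show "\<exists>X\<in>rows (f 1) s'. \<not> monochromatic X (F e)" if e: "e < f 2"
  proof -
    have "s' ''w'' e \<le> sum (s' ''w'') {..<f 2}"
      using e by (intro member_le_sum) auto
    also have "\<dots> \<le> f 2" using I by (simp add: I_def)
    finally have "s' ''w'' e \<noteq> 2 ^ ((k - 1) * f 0)" using few by simp
    moreover have "s' ''w'' e = 0 \<and> (\<exists>X\<in>rows (f 1) s'. \<not> monochromatic X (F e)) \<or>
      s' ''w'' e = 2 ^ ((k - 1) * f 0)"
      using I e unfolding I_def by (elim conjE allE[of _ e]) (rule mp)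
    ultimately show ?thesis by (elim disjE conjE) simp_all
  qed
qed

section \<open>Binary expansions as further rows\<close>

primrec from_bits :: "(nat \<Rightarrow> nat) \<Rightarrow> nat \<Rightarrow> nat" where
  "from_bits X 0 = 0"
| "from_bits X (Suc v) = 2 * from_bits X v + X v"

lemma from_bits_cong: "(\<And>u. u < v \<Longrightarrow> X u = Y u) \<Longrightarrow> from_bits X v = from_bits Y v"
  by (induction v) simp_all

text \<open>Long division in base two: after \<open>v\<close> digits, \<open>2 ^ v * j\<close>
  divided by \<open>2 ^ n\<close> has the digits so far as quotient and \<open>t\<close> as
  remainder, so after \<open>n\<close> digits the quotient is \<open>j\<close> itself.\<close>

lemma run_expand:
  fixes s :: store
  defines "n \<equiv> s ''in'' 1" and "o' \<equiv> s ''o'' 0" and "s' \<equiv> run expand s"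
  assumes H: "s ''H'' 0 = 2 ^ n" and bits: "\<And>i. s ''out'' i \<le> 1"
  shows "\<And>i. i < o' \<Longrightarrow> s' ''out'' i = s ''out'' i"
    and "\<And>i. s' ''out'' i \<le> 1"
    and "s ''j'' 0 < 2 ^ n \<Longrightarrow> from_bits (\<lambda>u. s' ''out'' (o' + u)) n = s ''j'' 0"
proof -
  define j where "j = s ''j'' 0"
  define p where "p = set_var ''t'' (Plus (var ''t'') (var ''t'')) ;;
        Cond (Less (var ''t'') (var ''H''))
          (Asg ''out'' (Plus (var ''o'') (var ''v'')) (N 0))
          (Asg ''out'' (Plus (var ''o'') (var ''v'')) (N 1) ;;
           set_var ''t'' (Minus (var ''t'') (var ''H'')))"
  define s0 where "s0 = update s ''t'' 0 j"
  \<comment> \<open>For \<open>j \<ge> 2 ^ n\<close> the digits do not represent \<open>j\<close>;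
    only their being bits is then claimed.\<close>
  define I where "I = (\<lambda>v r. (\<forall>i<o'. r ''out'' i = s ''out'' i) \<and> (\<forall>i. r ''out'' i \<le> 1) \<and>
    (j < 2 ^ n \<longrightarrow> r ''t'' 0 < 2 ^ n \<and>
      r ''t'' 0 + 2 ^ n * from_bits (\<lambda>u. r ''out'' (o' + u)) v = 2 ^ v * j))"
  have "I (s0 ''in'' 1) (run (For ''v'' 1 p) s0)"
  proof (rule run_For)
    show "wf_prog (For ''v'' 1 p)" by (simp add: p_def)
    show "I 0 (update s0 ''v'' 0 0)" using bits by (simp add: I_def s0_def)
  next
    fix v r
    assume v: "r ''v'' 0 = v" and I: "I v r"
      and fr1: "\<And>a. a \<noteq> ''v'' \<Longrightarrow> a \<notin> writes p \<Longrightarrow> r a = s0 a"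
    have fr: "r ''H'' = s ''H''" "r ''o'' = s ''o''"
      by (simp_all add: fr1 p_def s0_def)
    define b :: nat where "b = of_bool (2 ^ n \<le> r ''t'' 0 + r ''t'' 0)"
    define r' where "r' = run p r"
    have "bval (Less (var ''t'') (var ''H'')) (update r ''t'' 0 (r ''t'' 0 + r ''t'' 0)) \<longleftrightarrow> b = 0"
      by (simp add: b_def fr H not_le)
    note cond = this[unfolded bval.simps]
    have b: "b = 0 \<or> b = 1" by (simp add: b_def)
    have "r' ''out'' = (r ''out'')(o' + v := b) \<and> r' ''t'' 0 = r ''t'' 0 + r ''t'' 0 - 2 ^ n * b"
    proof (cases "b = 0")
      case True
      then show ?thesis
        using cond unfolding r'_def p_def by (simp add: v fr o'_def)
    next
      case False
      then have b1: "b = 1" using b by simp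
      define r1 where "r1 = update (update r ''t'' 0 (r ''t'' 0 + r ''t'' 0)) ''out'' (o' + v) 1"
      have r1: "r1 ''out'' = (r ''out'')(o' + v := 1)" "r1 ''t'' 0 = r ''t'' 0 + r ''t'' 0" "r1 ''H'' 0 = 2 ^ n"
        by (simp_all add: r1_def fr H)
      have r': "r' = update r1 ''t'' 0 (r1 ''t'' 0 - r1 ''H'' 0)"
        using cond False unfolding r'_def p_def r1_def by (simp add: v fr o'_def)
      have "r' ''out'' = (r ''out'')(o' + v := b)"
        unfolding b1 unfolding r' by (subst update_other, simp, rule r1)
      moreover have "r' ''t'' 0 = r ''t'' 0 + r ''t'' 0 - 2 ^ n * b"
        unfolding r' b1 by (simp add: r1(2,3))
      ultimately show ?thesis ..
    qed
    then have out: "r' ''out'' = (r ''out'')(o' + v := b)"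
      and t: "r' ''t'' 0 = 2 * r ''t'' 0 - 2 ^ n * b"
      by (simp_all add: mult_2[symmetric])
    have fb: "from_bits (\<lambda>u. r' ''out'' (o' + u)) v = from_bits (\<lambda>u. r ''out'' (o' + u)) v"
      by (intro from_bits_cong) (simp add: out)
    have "r' ''t'' 0 < 2 ^ n \<and>
      r' ''t'' 0 + 2 ^ n * from_bits (\<lambda>u. r' ''out'' (o' + u)) (Suc v) = 2 ^ Suc v * j" if "j < 2 ^ n"
    proof -
      have t0: "r ''t'' 0 < 2 ^ n"
        and eq: "r ''t'' 0 + 2 ^ n * from_bits (\<lambda>u. r ''out'' (o' + u)) v = 2 ^ v * j"
        using I that by (simp_all add: I_def)
      have t1: "r' ''t'' 0 < 2 ^ n" "r' ''t'' 0 + 2 ^ n * b = 2 * r ''t'' 0"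
      proof -
        consider "b = 0" "r ''t'' 0 + r ''t'' 0 < 2 ^ n" | "b = 1" "2 ^ n \<le> r ''t'' 0 + r ''t'' 0"
          by (cases "2 ^ n \<le> r ''t'' 0 + r ''t'' 0") (simp_all add: b_def)
        then have "r' ''t'' 0 < 2 ^ n \<and> r' ''t'' 0 + 2 ^ n * b = 2 * r ''t'' 0"
          by cases (use t t0 in simp_all)
        then show "r' ''t'' 0 < 2 ^ n" "r' ''t'' 0 + 2 ^ n * b = 2 * r ''t'' 0" by simp_all
      qed
      have "r' ''t'' 0 + 2 ^ n * from_bits (\<lambda>u. r' ''out'' (o' + u)) (Suc v) =
          (r' ''t'' 0 + 2 ^ n * b) + 2 * (2 ^ n * from_bits (\<lambda>u. r ''out'' (o' + u)) v)"
        using fb by (simp add: out algebra_simps)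
      also have "\<dots> = 2 * (r ''t'' 0 + 2 ^ n * from_bits (\<lambda>u. r ''out'' (o' + u)) v)"
        by (simp only: t1(2) distrib_left)
      finally show ?thesis using eq t1(1) by simp
    qed
    moreover have "\<forall>i<o'. r' ''out'' i = s ''out'' i" "\<forall>i. r' ''out'' i \<le> 1"
      using I by (simp_all add: I_def out b_def)
    ultimately show "I (Suc v) (update (run p r) ''v'' 0 (Suc v))"
      unfolding I_def r'_def[symmetric] by (simp del: from_bits.simps)
  qed
  moreover have "s' = run (For ''v'' 1 p) s0"
    by (simp add: s'_def expand_def p_def s0_def j_def)
  ultimately have I: "I n s'" by (simp add: s0_def n_def)
  then show "\<And>i. i < o' \<Longrightarrow> s' ''out'' i = s ''out'' i" and "\<And>i. s' ''out'' i \<le> 1"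
    by (simp_all add: I_def)
  assume "s ''j'' 0 < 2 ^ n"
  then have t: "s' ''t'' 0 < 2 ^ n"
    and eq: "s' ''t'' 0 + 2 ^ n * from_bits (\<lambda>u. s' ''out'' (o' + u)) n = 2 ^ n * j"
    using I by (simp_all add: I_def j_def)
  from eq have "(s' ''t'' 0 + 2 ^ n * from_bits (\<lambda>u. s' ''out'' (o' + u)) n) div 2 ^ n = j" by simp
  then show "from_bits (\<lambda>u. s' ''out'' (o' + u)) n = s ''j'' 0"
    using t by (simp add: j_def)
qed

text \<open>Pigeonhole: every candidate tried while \<open>r < x\<close> ends up among the finished
  rows. If \<open>r\<close> never reached \<open>x\<close>, then \<open>from_bits\<close> would take
  all \<open>x\<close> values below \<open>x\<close> on these rows, and there would be at least
  \<open>x\<close> of them after all.\<close>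

lemma run_phase2:
  fixes s :: store
  defines "n \<equiv> s ''in'' 1" and "x \<equiv> s ''in'' 0" and "s' \<equiv> run phase2 s"
  assumes inv: "rows_inv n s" and r: "s ''r'' 0 \<le> x"
  shows "rows_inv n s'" and "rows n s \<subseteq> rows n s'" and "s' ''r'' 0 \<le> x"
    and "x \<le> 2 ^ n \<Longrightarrow> s' ''r'' 0 = x"
proof -
  define s0 where "s0 = run (For ''v'' 1 (set_var ''H'' (Plus (var ''H'') (var ''H'')))) (update s ''H'' 0 1)"
  have fr0: "s0 ''in'' = s ''in''" "s0 ''out'' = s ''out''" "s0 ''o'' = s ''o''" "s0 ''r'' = s ''r''"
    by (simp_all add: s0_def run_frame)
  have "s0 ''H'' 0 = 2 ^ (update s ''H'' 0 1) ''in'' 1"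
    unfolding s0_def
    by (rule run_For[where I = "\<lambda>j s'. s' ''H'' 0 = 2 ^ j"]) simp_all
  then have H: "s0 ''H'' 0 = 2 ^ n" by (simp add: n_def)
  define p where "p = When (Less (var ''r'') (Arr ''in'' (N 0))) (expand ;; commit)"
  define I where "I = (\<lambda>j q. rows_inv n q \<and> rows n s \<subseteq> rows n q \<and> q ''r'' 0 \<le> x \<and>
    (x \<le> 2 ^ n \<longrightarrow> q ''r'' 0 = x \<or> {..<j} \<subseteq> (\<lambda>X. from_bits X n) ` rows n q))"
  have "I (s0 ''in'' 0) (run (For ''j'' 0 p) s0)"
  proof (rule run_For)
    show "wf_prog (For ''j'' 0 p)" by (simp add: p_def)
    have "rows_inv n s0" "rows n s0 = rows n s"
      using inv by (simp_all add: rows_inv_def rows_def fr0)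
    then show "I 0 (update s0 ''j'' 0 0)"
      using r by (simp add: I_def rows_inv_update fr0)
  next
    fix j q
    assume j: "j < s0 ''in'' 0" "q ''j'' 0 = j" and I: "I j q"
      and fr1: "\<And>a. a \<noteq> ''j'' \<Longrightarrow> a \<notin> writes p \<Longrightarrow> q a = s0 a"
    have q: "q ''in'' = s ''in''" "q ''H'' 0 = 2 ^ n" using H by (simp_all add: fr1 p_def fr0)
    have "I (Suc j) (run p q)"
    proof (cases "q ''r'' 0 < x")
      case False
      then have "q ''r'' 0 = x" "run p q = q" using I q by (simp_all add: I_def p_def x_def)
      then show ?thesis using I by (simp add: I_def)
    next
      case True
      have inv_q: "rows_inv n q" using I by (simp add: I_def)
      then have o: "q ''o'' 0 = q ''r'' 0 * n" and bits: "\<And>i. q ''out'' i \<le> 1"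
        by (simp_all add: rows_inv_def)
      define q1 where "q1 = run expand q"
      define q2 where "q2 = run commit q1"
      define X where "X = row n (q1 ''out'') (q ''r'' 0)"
      have q2: "run p q = q2" using True by (simp add: p_def q x_def q1_def q2_def)
      have frq: "q1 ''in'' = s ''in''" "q1 ''r'' = q ''r''" "q1 ''o'' = q ''o''"
        by (simp_all add: q1_def run_frame q)
      note ex = run_expand[of q, folded q1_def, unfolded q n_def[symmetric] j(2), OF refl bits]
      have commit: "rows_inv n q2" "rows n q2 = insert X (rows n q)" "q2 ''r'' 0 \<le> q ''r'' 0 + 1"
        using commit_rows[of n q q1, folded q2_def X_def] inv_q frq True ex(1,2)
        by (simp_all add: n_def x_def)
      have "{..<Suc j} \<subseteq> (\<lambda>X. from_bits X n) ` rows n q2" if x: "x \<le> 2 ^ n"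
      proof -
        have "from_bits X n = from_bits (\<lambda>u. q1 ''out'' (q ''o'' 0 + u)) n"
          by (intro from_bits_cong) (simp add: X_def row_def o)
        also have "\<dots> = j" using ex(3) x j(1) by (simp add: x_def fr0)
        finally have "from_bits X n = j" .
        moreover have "{..<j} \<subseteq> (\<lambda>X. from_bits X n) ` rows n q"
          using I x True by (simp add: I_def)
        ultimately show ?thesis by (auto simp: lessThan_Suc commit(2))
      qed
      then show ?thesis using I commit True by (auto simp: I_def q2)
    qed
    then show "I (Suc j) (update (run p q) ''j'' 0 (Suc j))"
      by (simp add: I_def rows_inv_update)
  qed
  moreover have "s' = run (For ''j'' 0 p) s0"
    by (simp add: s'_def phase2_def p_def s0_def)
  ultimately have I: "I x s'" by (simp add: fr0 x_def)
  then show "rows_inv n s'" and "rows n s \<subseteq> rows n s'" and le: "s' ''r'' 0 \<le> x"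
    by (simp_all add: I_def)
  assume "x \<le> 2 ^ n"
  then consider "s' ''r'' 0 = x" | "{..<x} \<subseteq> (\<lambda>X. from_bits X n) ` rows n s'"
    using I by (auto simp: I_def)
  then show "s' ''r'' 0 = x"
  proof cases
    case 2
    then have "x \<le> card ((\<lambda>X. from_bits X n) ` rows n s')"
      using card_mono[OF _ 2] by (simp add: rows_def)
    also have "\<dots> \<le> card (rows n s')" by (intro card_image_le) (simp add: rows_def)
    also have "\<dots> \<le> card {..<s' ''r'' 0}" unfolding rows_def by (intro card_image_le) simp
    finally show ?thesis using le by simp
  qed
qed
section \<open>Correctness on encoded hypergraphs\<close>

text \<open>The summand \<open>1\<close> skips the length entry; uniformity makes block
  \<open>e\<close> start at a multiple of \<open>k + 1\<close>.\<close>

lemma blocks_nth: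
  assumes "\<forall>l\<in>set es. length l = k" "e < length es" "i < k"
  shows "concat (map (\<lambda>l. length l # l) es) ! (1 + e * (k + 1) + i) = es ! e ! i"
  using assms
proof (induction es arbitrary: e)
  case (Cons l es)
  show ?case
  proof (cases e)
    case 0
    then show ?thesis using Cons.prems by (simp add: nth_append)
  next
    case (Suc d)
    have "concat (map (\<lambda>l. length l # l) es) ! (1 + d * (k + 1) + i) = es ! d ! i"
      using Cons.prems Suc by (intro Cons.IH) auto
    moreover have "1 + e * (k + 1) + i = length (length l # l) + (1 + d * (k + 1) + i)"
      using Cons.prems Suc by simp
    ultimately show ?thesis
      using Suc by (simp only: list.map concat.simps nth_append_length_plus nth_Cons_Suc)
  qed
qed simp

lemma length_blocks:
  "\<forall>l\<in>set es. length l = k \<Longrightarrow> length (concat (map (\<lambda>l. length l # l) es)) = length es * (k + 1)"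
  by (induction es) simp_all

lemma in_edge_initial_store:
  assumes len: "\<forall>l\<in>set es. length l = k" and e: "e < length es"
  shows "in_edge (initial_store (encode x n es) ''in'') e v \<longleftrightarrow> v \<in> set (es ! e)"
proof -
  define f where "f = initial_store (encode x n es) ''in''"
  define B where "B = concat (map (\<lambda>l. length l # l) es)"
  have f: "f (3 + i) = (if i < length B then B ! i else 0)" for i
    by (simp add: f_def initial_store_def encode_def B_def)
  have B: "length B = length es * (k + 1)" unfolding B_def by (rule length_blocks[OF len])
  have k: "length (es ! e) = k" using len e by simp
  \<comment> \<open>As there is a hyperedge, index \<open>3\<close> holds its length field and not
    the default \<open>0\<close>.\<close>
  obtain l ls where "es = l # ls" using e by (cases es) auto
  then have "B ! 0 = k" "0 < length B" using len by (simp_all add: B_def)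
  then have f3: "f 3 = k" using f[of 0] by simp
  have "f (4 + e * (f 3 + 1) + i) = es ! e ! i" if i: "i < k" for i
  proof -
    \<comment> \<open>The address lies inside the encoding, so no default value is read.\<close>
    have "1 + e * (k + 1) + i < (e + 1) * (k + 1)" using i by simp
    also have "\<dots> \<le> length B" unfolding B using e by (intro mult_right_mono) auto
    finally have "f (3 + (1 + e * (k + 1) + i)) = es ! e ! i"
      using blocks_nth[OF len e i] by (simp only: f if_True B_def)
    moreover have "4 + e * (f 3 + 1) + i = 3 + (1 + e * (k + 1) + i)" using f3 by simp
    ultimately show ?thesis by (simp only:)
  qed
  then show ?thesis
    unfolding in_edge_def f_def[symmetric] in_set_conv_nth k f3 by (metis f3)
qed

text \<open>\<open>input_size\<close> counts \<open>x\<close> and \<open>n\<close> in unary, and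
  \<open>k\<close> is less than the length of the first block; without hyperedges entry
  \<open>3\<close> is the default \<open>0\<close>.\<close>

lemma initial_store_header_le:
  assumes len: "\<forall>l\<in>set es. length l = k" and b: "b < 4"
  shows "initial_store (encode x n es) ''in'' b \<le> input_size x n es"
proof -
  have size: "input_size x n es = x + n + 3 + length es * (k + 1)"
    using length_blocks[OF len] by (simp add: input_size_def encode_def)
  consider "b = 0" | "b = 1" | "b = 2" | "b = 3" "es = []" | l ls where "b = 3" "es = l # ls"
    using b by (cases es) (auto simp: less_Suc_eq numeral_eq_Suc)
  then show ?thesis
    unfolding size by cases (use len in \<open>auto simp: initial_store_def encode_def\<close>)
qed

text \<open>The \<open>- 1\<close> in the exponent makes the bound strict. For \<open>k = 0\<close>
  the real factor \<open>k - 1\<close> is negative while the truncated one is \<open>0\<close>,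
  hence only an inequality between the exponents.\<close>

lemma few_edges:
  assumes "real m \<le> 2 powr ((real k - 1) * real x - 1)"
  shows "m < 2 ^ ((k - 1) * x)"
proof -
  have "(real k - 1) * real x \<le> real (k - 1) * real x"
    by (intro mult_right_mono) auto
  then have "2 powr ((real k - 1) * real x - 1) < 2 powr (real ((k - 1) * x))"
    by simp
  also have "\<dots> = real (2 ^ ((k - 1) * x))"
    by (subst powr_realpow) simp_all
  finally show ?thesis using assms by linarith
qed

lemma run_correct:
  assumes unif: "uniform_hypergraph k {..<n} E"
    and few: "real (card E) \<le> 2 powr ((real k - 1) * real x - 1)"
    and es: "edge_list es E"
  shows "\<forall>l\<in>set es. length l = k"
    and "bicoloring_cover_of_size {..<n} E x
      (decode x n (run (phase1 ;; phase2) (initial_store (encode x n es)) ''out''))"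
proof -
  have E: "E = set (map set es)" using es by (auto simp: edge_list_def)
  have "distinct (map set es)" using es by (simp add: edge_list_def)
  from distinct_card[OF this] have m: "card E = length es" by (simp add: E)
  have l: "set l \<subseteq> {..<n} \<and> card (set l) = k \<and> distinct l" if "l \<in> set es" for l
  proof -
    have "set l \<in> E" using that by (simp add: E)
    then show ?thesis using unif es that by (simp add: uniform_hypergraph_def edge_list_def subset_iff)
  qed
  then show len: "\<forall>l\<in>set es. length l = k" by (metis distinct_card)
  define s where "s = initial_store (encode x n es)"
  define s1 where "s1 = run phase1 s"
  define s2 where "s2 = run phase2 s1"
  define F where "F e = set (es ! e)" for e
  have f: "s ''in'' 0 = x" "s ''in'' 1 = n" "s ''in'' 2 = length es"
    by (simp_all add: s_def initial_store_def encode_def)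
  have f1: "s1 ''in'' = s ''in''" by (simp add: s1_def run_in)
  have edge: "in_edge (s ''in'') e v \<longleftrightarrow> v \<in> F e" if "e < length es" for e v
    using in_edge_initial_store[OF len that] by (simp add: s_def F_def)
  have F: "F e \<subseteq> {..<n}" "card (F e) = k" if "e < length es" for e
    using l[of "es ! e"] that by (simp_all add: F_def)
  have inv: "rows_inv n s" "s ''r'' 0 = 0"
    by (simp_all add: rows_inv_def s_def initial_store_def)
  have less: "length es < 2 ^ ((k - 1) * x)" using few_edges few by (simp add: m)
  have p1: "rows_inv n s1" "s1 ''r'' 0 \<le> x"
    "\<And>e. e < length es \<Longrightarrow> \<exists>X\<in>rows n s1. \<not> monochromatic X (F e)"
    unfolding s1_def
    by (rule run_phase1[of s F k, unfolded f]; (rule edge F inv less)?; assumption)+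
  have p2: "rows_inv n s2" "rows n s1 \<subseteq> rows n s2" "s2 ''r'' 0 \<le> x"
    "x \<le> 2 ^ n \<Longrightarrow> s2 ''r'' 0 = x"
    using run_phase2[of s1, unfolded f1 f, folded s2_def] p1 by blast+
  define D where "D = decode x n (s2 ''out'')"
  have D: "D = row n (s2 ''out'') ` {..<x}"
    by (simp add: D_def decode_def row_def[abs_def])
  have "D \<subseteq> bicolorings {..<n}"
  proof -
    \<comment> \<open>This covers unfinished rows as well: \<open>decode\<close> reads them when
      \<open>r < x\<close>, which can happen if \<open>2 ^ n < x\<close>.\<close>
    have "s2 ''out'' i \<in> {0, 1}" for i
      using p2(1) by (auto simp: rows_inv_def le_Suc_eq)
    then have "row n (s2 ''out'') h \<in> bicolorings {..<n}" for h
      unfolding bicolorings_def row_def by (intro restrict_PiE_iff[THEN iffD2] ballI) blast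
    then show ?thesis unfolding D by blast
  qed
  moreover have "\<exists>X\<in>D. \<not> monochromatic X e" if "e \<in> E" for e
  proof -
    obtain i where i: "i < length es" "e = F i"
      using \<open>e \<in> E\<close> by (auto simp: E F_def in_set_conv_nth)
    obtain X where X: "X \<in> rows n s1" "\<not> monochromatic X e" using p1(3)[OF i(1)] i(2) by blast
    have "rows n s2 \<subseteq> D" unfolding rows_def D using p2(3) by (intro image_mono) simp
    then show ?thesis using X p2(2) by blast
  qed
  moreover have "card D \<le> x" unfolding D using card_image_le[of "{..<x}"] by simp
  \<comment> \<open>In this case all \<open>x\<close> decoded rows are finished, hence pairwise
    distinct.\<close>
  moreover have "card D = x" if "x \<le> 2 ^ n"
    using p2(1) p2(4)[OF that] unfolding D rows_inv_def by (simp add: card_image)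
  ultimately show "bicoloring_cover_of_size {..<n} E x
      (decode x n (run (phase1 ;; phase2) (initial_store (encode x n es)) ''out''))"
    by (simp add: bicoloring_cover_of_size_def bicoloring_cover_def D_def s2_def s1_def s_def)
qed

text \<open>The vertices are numbered, the output of the algorithm on the renamed hypergraph
  provides a cover, and its bicolorings are pulled back along the numbering.\<close>

lemma bicoloring_cover_exists:
  fixes V :: "'a set"
  assumes unif: "uniform_hypergraph k V E"
    and few: "real (card E) \<le> 2 powr ((real k - 1) * real x - 1)"
  shows "\<exists>C. bicoloring_cover_of_size V E x C"
proof -
  define n where "n = card V"
  have V: "finite V" "E \<subseteq> Pow V" and k: "\<And>e. e \<in> E \<Longrightarrow> card e = k"
    using unif by (auto simp: uniform_hypergraph_def)
  obtain h where "bij_betw h V {0..<card V}" using ex_bij_betw_finite_nat[OF V(1)] by blast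
  then have h: "inj_on h V" "h ` V = {..<n}" by (auto simp: bij_betw_def n_def)
  define E' where "E' = (`) h ` E"
  have finE: "finite E" using V by (auto intro: finite_subset)
  have "card (h ` e) = k" if "e \<in> E" for e
    using k[OF that] V that h(1) by (subst card_image) (auto intro: inj_on_subset)
  then have unif': "uniform_hypergraph k {..<n} E'"
    using V(2) h(2) by (fastforce simp: uniform_hypergraph_def E'_def)
  have "card E' \<le> card E" unfolding E'_def by (rule card_image_le[OF finE])
  then have few': "real (card E') \<le> 2 powr ((real k - 1) * real x - 1)" using few by linarith
  have fin: "finite e" if "e \<in> E'" for e
    using unif' that unfolding uniform_hypergraph_def by (auto intro: finite_subset)
  obtain ls where ls: "set ls = E'" "distinct ls"
    using finite_distinct_list[of E'] finE by (auto simp: E'_def)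
  have id: "map set (map sorted_list_of_set ls) = ls"
    using fin ls(1) by (auto intro!: map_idI)
  have "edge_list (map sorted_list_of_set ls) E'"
    unfolding edge_list_def id using ls id by (metis distinct_sorted_list_of_set ex_map_conv list.set_map)
  from run_correct(2)[OF unif' few' this] obtain C'
    where "bicoloring_cover_of_size {..<n} E' x C'" by blast
  then have C': "C' \<subseteq> bicolorings {..<n}" "\<And>e. e \<in> E' \<Longrightarrow> \<exists>X\<in>C'. \<not> monochromatic X e"
    "card C' \<le> x" "x \<le> 2 ^ n \<Longrightarrow> card C' = x"
    by (auto simp: bicoloring_cover_of_size_def bicoloring_cover_def)
  \<comment> \<open>Restriction to \<open>V\<close> makes the pullback extensional. Since
    \<open>h\<close> maps onto \<open>{..<n}\<close> and bicolorings are extensional,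
    \<open>pull\<close> is injective on \<open>C'\<close> and the cardinality is preserved.\<close>
  define pull :: "(nat \<Rightarrow> nat) \<Rightarrow> 'a \<Rightarrow> nat" where "pull X = (\<lambda>v\<in>V. X (h v))" for X
  have "inj_on pull C'"
  proof (rule inj_onI)
    fix X Y assume XY: "X \<in> C'" "Y \<in> C'" "pull X = pull Y"
    have "X u = Y u" if u: "u \<in> {..<n}" for u
    proof -
      obtain v where v: "v \<in> V" "u = h v" using u h(2) by blast
      then show ?thesis using fun_cong[OF XY(3), of v] by (simp add: pull_def)
    qed
    then show "X = Y"
      using XY(1,2) C'(1) unfolding bicolorings_def by (meson PiE_ext subsetD)
  qed
  then have card: "card (pull ` C') = card C'" by (rule card_image)
  have "pull X \<in> bicolorings V" if "X \<in> C'" for X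
  proof -
    have "X (h v) \<in> {0, 1}" if "v \<in> V" for v
      using C'(1) \<open>X \<in> C'\<close> h(2) that unfolding bicolorings_def by blast
    then show ?thesis
      unfolding bicolorings_def pull_def by (intro restrict_PiE_iff[THEN iffD2] ballI)
  qed
  moreover have "\<exists>X\<in>pull ` C'. \<not> monochromatic X e" if e: "e \<in> E" for e
  proof -
    have "h ` e \<in> E'" using e by (simp add: E'_def)
    then obtain X where X: "X \<in> C'" "\<not> monochromatic X (h ` e)" using C'(2) by blast
    then obtain u v where "u \<in> e" "v \<in> e" "X (h u) \<noteq> X (h v)"
      by (auto simp: monochromatic_def)
    moreover have "e \<subseteq> V" using e V(2) by blast
    ultimately have "\<not> monochromatic (pull X) e"
      by (auto simp: monochromatic_def pull_def subset_iff)
    then show ?thesis using X(1) by blast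
  qed
  ultimately have "bicoloring_cover_of_size V E x (pull ` C')"
    using C'(3,4) unfolding bicoloring_cover_of_size_def bicoloring_cover_def card n_def by blast
  then show ?thesis by blast
qed

theorem theorem11:
  shows "(\<forall>(x::nat) (k::nat) (V::'a set) (E::'a set set).
            0 < x \<and> uniform_hypergraph k V E \<and>
            real (card E) \<le> 2 powr ((real k - 1) * real x - 1) \<longrightarrow>
            (\<exists>C. bicoloring_cover_of_size V E x C)) \<and>
         (\<exists>(c::com) (P::nat poly).
            \<forall>(x::nat) (k::nat) (n::nat) (E::nat set set) (es::nat list list).
              0 < x \<and> uniform_hypergraph k {..<n} E \<and>
              real (card E) \<le> 2 powr ((real k - 1) * real x - 1) \<and>
              edge_list es E \<longrightarrow>
              solves_in_expected_time c (encode x n es)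
                (\<lambda>out. bicoloring_cover_of_size {..<n} E x (decode x n out))
                (of_nat (poly P (input_size x n es))))"
proof -
  \<comment> \<open>The program is fixed before any input, so one polynomial serves all instances;
    it bounds even the worst case.\<close>
  obtain P where P: "\<And>L. poly P L = time (phase1 ;; phase2) L"
    using time_poly by blast
  have "solves_in_expected_time (compile (phase1 ;; phase2)) (encode x n es)
      (\<lambda>out. bicoloring_cover_of_size {..<n} E x (decode x n out))
      (of_nat (poly P (input_size x n es)))"
    if "uniform_hypergraph k {..<n} E" "real (card E) \<le> 2 powr ((real k - 1) * real x - 1)"
      "edge_list es E" for x k n E es
    unfolding P
  proof (rule solves_in_expected_time_compile)
    show "wf_prog (phase1 ;; phase2)" by simp
    show "\<forall>b<4. initial_store (encode x n es) ''in'' b \<le> input_size x n es"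
      using initial_store_header_le[OF run_correct(1)[OF that]] by blast
    show "bicoloring_cover_of_size {..<n} E x
        (decode x n (run (phase1 ;; phase2) (initial_store (encode x n es)) ''out''))"
      by (rule run_correct(2)[OF that])
  qed
  then show ?thesis using bicoloring_cover_exists by blast
qed

end
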